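(* Let $B$ be a symmetric Fredholm bilinear form on a real separable Hilbert space $\mathcal H$ and let $\mathcal V$ be a closed finite codimensional subspace of $\mathcal H$. Denote by $T:\mathcal H\to\mathcal H$ and $\widetilde T=P_{\mathcal V}\circ T|_{\mathcal V}:\mathcal V\to\mathcal V$ the self-adjoint Fredholm operators associated with $B$ and $B|_{\mathcal V\times\mathcal V}$ respectively. Then $$\dim\big(V^-(T),V^-(\widetilde T)\big)=\mathrm n_-\big(B|_{\mathcal V^{\perp_B}\times\mathcal V^{\perp_B}}\big)+\dim\big(\mathcal V\cap\mathcal V^{\perp_B}\big)-\dim\big(\mathcal V\cap\mathrm{Ker}\,T\big).$$
   Context: $P_{\mathcal V}$ is the orthogonal projection onto $\mathcal V$. A continuous symmetric bilinear form $B$ is associated with the self-adjoint operator $T$ given by $B(x,y)=\langle Tx,y\rangle$; $B$ is a symmetric Fredholm form if $T$ is Fredholm. $\mathcal V^{\perp_B}=\{x\in\mathcal H:B(x,y)=0\ \forall y\in\mathcal V\}$. $\mathrm n_-(B)$ is the supremum of the dimensions of subspaces on which $B$ is negative definite. For a self-adjoint Fredholm operator $T$ there is a unique orthogonal splitting $\mathcal H=V^-(T)\oplus V^+(T)\oplus\mathrm{Ker}\,T$ into closed subspaces with $V^\pm(T)$ $T$-invariant and $\langle T\cdot,\cdot\rangle$ negative definite on $V^-(T)$ and positive definite on $V^+(T)$; $V^-(\widetilde T)\subseteq\mathcal V$ is regarded as a subspace of $\mathcal H$. Closed subspaces $\mathcal X,\mathcal Y$ of $\mathcal H$ are commensurable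 if $P_{\mathcal X}-P_{\mathcal Y}$ is compact, and then the relative dimension is $\dim(\mathcal X,\mathcal Y)=\dim(\mathcal X\cap\mathcal Y^\perp)-\dim(\mathcal Y\cap\mathcal X^\perp)$. In the present situation $V^-(T)$ and $V^-(\widetilde T)$ are commensurable. *)

theory Defs
  imports "HOL-Analysis.Analysis"
begin

text \<open>
  The Hilbert space is a type of sort real_inner and complete_space. An operator of a closed
  subspace \<open>W\<close> is a function on the whole type together with \<open>W\<close> as an explicit parameter;
  its values outside \<open>W\<close> are irrelevant.
\<close>

definition finite_dimensional :: "'a::real_vector set \<Rightarrow> bool" where
  "finite_dimensional S \<longleftrightarrow> (\<exists>F. finite F \<and> S \<subseteq> span F)"

definition finite_codimensional :: "'a::real_vector set \<Rightarrow> bool" where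
  "finite_codimensional S \<longleftrightarrow> (\<exists>F. finite F \<and> span (S \<union> F) = UNIV)"

text \<open>The library's \<open>dim\<close> is 0 on infinite-dimensional spaces, hence the extended version.\<close>

definition edim :: "'a::real_vector set \<Rightarrow> enat" where
  "edim S = (if finite_dimensional S then enat (dim S) else \<infinity>)"

definition orth_proj :: "'a::real_inner set \<Rightarrow> 'a \<Rightarrow> 'a" where
  "orth_proj V x = (THE p. p \<in> V \<and> x - p \<in> V\<^sup>\<bottom>)"

definition compact_operator :: "('a::real_normed_vector \<Rightarrow> 'b::real_normed_vector) \<Rightarrow> bool" where
  "compact_operator K \<longleftrightarrow> bounded_linear K \<and> compact (closure (K ` cball 0 1))"

definition fredholm_operator :: "('a::real_normed_vector \<Rightarrow> 'b::real_normed_vector) \<Rightarrow> bool" where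
  "fredholm_operator T \<longleftrightarrow> bounded_linear T \<and> finite_dimensional {x. T x = 0} \<and>
     closed (range T) \<and> finite_codimensional (range T)"

definition associated_operator :: "('a::real_inner \<Rightarrow> 'a \<Rightarrow> real) \<Rightarrow> ('a \<Rightarrow> 'a) \<Rightarrow> bool" where
  "associated_operator B T \<longleftrightarrow> (\<forall>x y. B x y = T x \<bullet> y)"

definition symmetric_fredholm_form :: "('a::real_inner \<Rightarrow> 'a \<Rightarrow> real) \<Rightarrow> bool" where
  "symmetric_fredholm_form B \<longleftrightarrow> bounded_bilinear B \<and> (\<forall>x y. B x y = B y x) \<and>
     (\<exists>T. associated_operator B T \<and> fredholm_operator T)"

definition form_perp :: "('a::real_vector \<Rightarrow> 'a \<Rightarrow> real) \<Rightarrow> 'a set \<Rightarrow> 'a set" where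
  "form_perp B V = {x. \<forall>y\<in>V. B x y = 0}"

definition negative_definite_on :: "'a::real_vector set \<Rightarrow> ('a \<Rightarrow> 'a \<Rightarrow> real) \<Rightarrow> bool" where
  "negative_definite_on S B \<longleftrightarrow> (\<forall>x\<in>S. x \<noteq> 0 \<longrightarrow> B x x < 0)"

definition positive_definite_on :: "'a::real_vector set \<Rightarrow> ('a \<Rightarrow> 'a \<Rightarrow> real) \<Rightarrow> bool" where
  "positive_definite_on S B \<longleftrightarrow> (\<forall>x\<in>S. x \<noteq> 0 \<longrightarrow> B x x > 0)"

text \<open>The index of the restriction of \<open>B\<close> to the subspace \<open>W\<close>.\<close>

definition n_minus :: "'a::real_vector set \<Rightarrow> ('a \<Rightarrow> 'a \<Rightarrow> real) \<Rightarrow> enat" where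
  "n_minus W B = Sup (edim ` {S. subspace S \<and> S \<subseteq> W \<and> negative_definite_on S B})"

text \<open>\<open>W = N \<oplus> P \<oplus> Ker T\<close> for an operator \<open>T\<close> of \<open>W\<close>, with \<open>N = V\<^sup>-(T)\<close> and \<open>P = V\<^sup>+(T)\<close>.\<close>

definition spectral_splitting ::
    "'a::real_inner set \<Rightarrow> ('a \<Rightarrow> 'a) \<Rightarrow> 'a set \<Rightarrow> 'a set \<Rightarrow> bool" where
  "spectral_splitting W T N P \<longleftrightarrow>
     (let K = {x \<in> W. T x = 0} in
       subspace N \<and> closed N \<and> N \<subseteq> W \<and> subspace P \<and> closed P \<and> P \<subseteq> W \<and>
       (\<forall>x\<in>N. \<forall>y\<in>P. orthogonal x y) \<and>
       (\<forall>x\<in>N. \<forall>y\<in>K. orthogonal x y) \<and>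
       (\<forall>x\<in>P. \<forall>y\<in>K. orthogonal x y) \<and>
       (\<forall>w\<in>W. \<exists>x\<in>N. \<exists>y\<in>P. \<exists>z\<in>K. w = x + y + z) \<and>
       T ` N \<subseteq> N \<and> T ` P \<subseteq> P \<and>
       negative_definite_on N (\<lambda>x y. T x \<bullet> y) \<and>
       positive_definite_on P (\<lambda>x y. T x \<bullet> y))"

definition neg_space :: "'a::real_inner set \<Rightarrow> ('a \<Rightarrow> 'a) \<Rightarrow> 'a set" where
  "neg_space W T = (THE N. \<exists>P. spectral_splitting W T N P)"

definition commensurable :: "'a::real_inner set \<Rightarrow> 'a set \<Rightarrow> bool" where
  "commensurable X Y \<longleftrightarrow> subspace X \<and> closed X \<and> subspace Y \<and> closed Y \<and>
     compact_operator (\<lambda>x. orth_proj X x - orth_proj Y x)"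

text \<open>Only meaningful for commensurable \<open>X\<close> and \<open>Y\<close>; both dimensions are then finite.\<close>

definition relative_dim :: "'a::real_inner set \<Rightarrow> 'a set \<Rightarrow> int" where
  "relative_dim X Y = int (dim (X \<inter> Y\<^sup>\<bottom>)) - int (dim (Y \<inter> X\<^sup>\<bottom>))"

end

theory Submission
  imports Defs
begin

text \<open>
  Let \<open>K' = V \<inter> V\<^sup>\<bottom>\<^sup>B\<close> (the kernel of the compression of \<open>T\<close> to \<open>V\<close>) and let \<open>T' = P\<^sub>V T P\<^sub>V\<close> be the
  compression, extended by \<open>0\<close> to the whole space. Both \<open>T\<close> and \<open>T'\<close> are symmetric with closed range
  and finite-dimensional kernel, they differ by an operator of finite rank, and the negative space of
  the compression is that of \<open>T'\<close> (\<open>neg_space_compression\<close>). Write \<open>N\<close> and \<open>N'\<close> for the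
  negative spaces of \<open>T\<close> and \<open>T'\<close>.

  The negative space of a symmetric operator comes from its sign. After adding the projection
  onto the kernel and rescaling, one has an operator \<open>U\<close> with \<open>g \<parallel>x\<parallel> \<le> \<parallel>U x\<parallel> \<le> \<parallel>x\<parallel>\<close> for some \<open>g > 0\<close>. The
  operator \<open>Y = 1 - \<bar>U\<bar>\<close> is the fixed point of the contraction \<open>y \<mapsto> (1 - U\<^sup>2 + y\<^sup>2) / 2\<close>, and the sign
  \<open>J = \<bar>U\<bar>\<^sup>-\<^sup>1 U\<close> is the fixed point of \<open>j \<mapsto> U + Y j\<close> (\<open>operator_sign_exists\<close>). The negative space is the
  eigenspace of \<open>J\<close> for \<open>-1\<close>, with orthogonal projection \<open>(1 - J) / 2\<close>. The two fixed point equations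
  are also stable under compact perturbations: the difference of the fixed points for two operators
  solves a contractive equation with compact inhomogeneous part, hence it is compact
  (\<open>operator_sign_difference_compact\<close>). This proves that \<open>N\<close> and \<open>N'\<close> are commensurable.

  For the dimension formula, \<open>N' \<inter> N\<^sup>\<bottom> = 0\<close>, since the form is negative definite on \<open>N'\<close> and nonnegative
  on \<open>N\<^sup>\<bottom>\<close>. So the relative dimension is \<open>dim (N \<inter> N'\<^sup>\<bottom>)\<close>, and no index theory is needed to
  compute it. Let \<open>E\<close> be the complement of \<open>range T'\<close> for the form; it is finite-dimensional, and the whole space is
  the sum of \<open>range T'\<close> and \<open>E\<close>. If \<open>F\<close> is a maximal negative subspace of \<open>E\<close>, then \<open>N' + F\<close> is
  a maximal negative subspace of the whole space, and so is \<open>N\<close>; comparing the two gives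
  \<open>dim (N \<inter> N'\<^sup>\<bottom>) = dim F\<close> (\<open>dim_neg_space_perp\<close>). What remains is linear algebra in \<open>E\<close>. The space \<open>K'\<close> is
  isotropic and its complement in \<open>E\<close> is \<open>V\<^sup>\<bottom>\<^sup>B\<close>. Choosing \<open>F\<close> as an extension of a maximal negative
  subspace \<open>F\<^sub>0\<close> of \<open>V\<^sup>\<bottom>\<^sup>B\<close>, the form pairs \<open>F / F\<^sub>0\<close> with \<open>K' / (V \<inter> Ker T)\<close> without a kernel on either side
  (\<open>dim_neg_space_perp_eq\<close>).
\<close>

section \<open>Orthogonal projections\<close>

lemma orth_comp_iff: "x \<in> V\<^sup>\<bottom> \<longleftrightarrow> (\<forall>y\<in>V. x \<bullet> y = 0)"
  by (auto simp: orthogonal_comp_def orthogonal_def inner_commute)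

lemma closed_orth_comp: "closed (V\<^sup>\<bottom>)"
proof -
  have "V\<^sup>\<bottom> = (\<Inter>y\<in>V. {x. x \<bullet> y = 0})"
    by (auto simp: orth_comp_iff)
  then show ?thesis
    by (auto intro!: closed_INT closed_Collect_eq continuous_intros)
qed

text \<open>
  By the parallelogram law, a sequence in \<open>V\<close> that minimizes the distance to \<open>x\<close> is a Cauchy sequence,
  and its limit is the projection.
\<close>

lemma projection_exists:
  fixes V :: "'a::{real_inner, complete_space} set"
  assumes V: "subspace V" "closed V"
  shows "\<exists>p\<in>V. x - p \<in> V\<^sup>\<bottom>"
proof -
  define d where "d = (INF v\<in>V. norm (x - v) ^ 2)"
  have ne: "V \<noteq> {}" using subspace_0[OF V(1)] by auto
  have bb: "bdd_below ((\<lambda>v. norm (x - v) ^ 2) ` V)"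
    by (rule bdd_belowI[of _ 0]) auto
  have dle: "d \<le> norm (x - v) ^ 2" if "v \<in> V" for v
    unfolding d_def using bb that by (rule cINF_lower)
  have "\<exists>v\<in>V. norm (x - v) ^ 2 < d + inverse (real (Suc n))" for n
  proof -
    have "Inf ((\<lambda>v. norm (x - v) ^ 2) ` V) < d + inverse (real (Suc n))"
      by (simp add: d_def)
    then show ?thesis
      using cInf_lessD[of "(\<lambda>v. norm (x - v) ^ 2) ` V"] ne by blast
  qed
  then obtain v where v: "\<And>n. v n \<in> V" "\<And>n. norm (x - v n) ^ 2 < d + inverse (real (Suc n))"
    by metis
  have par: "norm (v m - v n) ^ 2 \<le> 2 * (norm (x - v m) ^ 2 - d) + 2 * (norm (x - v n) ^ 2 - d)" for m n
  proof -
    have "(1/2) *\<^sub>R (v m + v n) \<in> V"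
      using v(1) V(1) by (simp add: subspace_add subspace_scale)
    from dle[OF this]
    have "d \<le> norm (x - (1/2) *\<^sub>R (v m + v n)) ^ 2" .
    moreover have "norm (v m - v n) ^ 2 + 4 * norm (x - (1/2) *\<^sub>R (v m + v n)) ^ 2
        = 2 * norm (x - v m) ^ 2 + 2 * norm (x - v n) ^ 2"
      by (simp add: power2_norm_eq_inner inner_simps inner_commute algebra_simps)
    moreover have "p \<le> 2 * (a - d) + 2 * (b - d)"
      if "d \<le> q" "p + 4 * q = 2 * a + 2 * b" for p q a b :: real
      using that by simp
    ultimately show ?thesis by blast
  qed
  have "Cauchy v"
  proof (rule metric_CauchyI)
    fix e :: real assume e: "e > 0"
    obtain N where N: "inverse (real (Suc N)) < e\<^sup>2 / 4"
      using reals_Archimedean[of "e\<^sup>2 / 4"] e by auto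
    have "dist (v m) (v n) < e" if "m \<ge> N" "n \<ge> N" for m n
    proof -
      have i: "inverse (real (Suc k)) \<le> inverse (real (Suc N))" if "k \<ge> N" for k
        using that by simp
      have "p < c" if "p \<le> 2 * (a - d) + 2 * (b - d)" "a < d + i" "b < d + j" "i \<le> k" "j \<le> k" "k < c / 4"
        for p a b c i j k :: real
        using that by simp
      from this[OF par v(2) v(2) i[OF that(1)] i[OF that(2)] N]
      have "norm (v m - v n) ^ 2 < e ^ 2" .
      then show ?thesis
        using e by (simp add: dist_norm power_less_imp_less_base)
    qed
    then show "\<exists>M. \<forall>m\<ge>M. \<forall>n\<ge>M. dist (v m) (v n) < e" by blast
  qed
  then obtain p where p: "v \<longlonglongrightarrow> p"
    using Cauchy_convergent_iff convergent_def by blast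
  have pV: "p \<in> V"
    using closed_sequentially[OF V(2)] v(1) p by blast
  have np: "norm (x - p) ^ 2 \<le> d"
  proof (rule LIMSEQ_le)
    show "(\<lambda>n. norm (x - v n) ^ 2) \<longlonglongrightarrow> norm (x - p) ^ 2"
      by (intro tendsto_intros p)
    show "(\<lambda>n. d + inverse (real (Suc n))) \<longlonglongrightarrow> d"
      using tendsto_add[OF tendsto_const LIMSEQ_inverse_real_of_nat, of d] by simp
    show "\<exists>N. \<forall>n\<ge>N. norm (x - v n) ^ 2 \<le> d + inverse (real (Suc n))"
      using v(2) less_imp_le by blast
  qed
  have "(x - p) \<bullet> y = 0" if y: "y \<in> V" for y
  proof (cases "y = 0")
    case False
    define t where "t = ((x - p) \<bullet> y) / (y \<bullet> y)"
    have yy: "y \<bullet> y > 0" using False by simp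
    have "p + t *\<^sub>R y \<in> V" using pV y V(1) by (simp add: subspace_add subspace_scale)
    then have "norm (x - p) ^ 2 \<le> norm (x - (p + t *\<^sub>R y)) ^ 2"
      using np dle order_trans by blast
    also have "\<dots> = norm (x - p) ^ 2 - 2 * t * ((x - p) \<bullet> y) + t * t * (y \<bullet> y)"
      by (simp add: power2_norm_eq_inner inner_simps inner_commute algebra_simps)
    also have "\<dots> = norm (x - p) ^ 2 - ((x - p) \<bullet> y) ^ 2 / (y \<bullet> y)"
      using yy by (simp add: t_def power2_eq_square)
    finally have "((x - p) \<bullet> y) ^ 2 / (y \<bullet> y) \<le> 0" by simp
    then show ?thesis
      using yy by (simp add: divide_le_0_iff)
  qed simp
  then have "x - p \<in> V\<^sup>\<bottom>" by (auto simp: orth_comp_iff)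
  with pV show ?thesis by blast
qed

lemma orth_proj_eqI:
  assumes "subspace V" "p \<in> V" "x - p \<in> V\<^sup>\<bottom>"
  shows "orth_proj V x = p"
  unfolding orth_proj_def
proof (rule the_equality)
  fix q assume q: "q \<in> V \<and> x - q \<in> V\<^sup>\<bottom>"
  have "q - p \<in> V" using q assms subspace_diff by blast
  moreover have "q - p \<in> V\<^sup>\<bottom>"
    using subspace_diff[OF subspace_orthogonal_comp assms(3) conjunct2[OF q]] by simp
  ultimately have "(q - p) \<bullet> (q - p) = 0" unfolding orth_comp_iff by blast
  then show "q = p" by simp
qed (use assms in auto)

locale closed_subspace =
  fixes V :: "'a::{real_inner, complete_space} set"
  assumes sub: "subspace V" and clo: "closed V"
begin

abbreviation "\<pi> \<equiv> orth_proj V"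

lemma proj_in [simp]: "\<pi> x \<in> V" and proj_perp: "x - \<pi> x \<in> V\<^sup>\<bottom>"
proof -
  obtain p where "p \<in> V" "x - p \<in> V\<^sup>\<bottom>" using projection_exists[OF sub clo] by blast
  with orth_proj_eqI[OF sub this] show "\<pi> x \<in> V" "x - \<pi> x \<in> V\<^sup>\<bottom>" by auto
qed

lemma proj_inner: "y \<in> V \<Longrightarrow> \<pi> x \<bullet> y = x \<bullet> y"
  using proj_perp[of x] by (auto simp: orth_comp_iff inner_diff_left)

lemma proj_inner': "y \<in> V \<Longrightarrow> y \<bullet> \<pi> x = y \<bullet> x"
  using proj_inner inner_commute by metis

lemma proj_id [simp]: "x \<in> V \<Longrightarrow> \<pi> x = x"
  by (rule orth_proj_eqI) (auto simp: sub subspace_0 subspace_orthogonal_comp)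

lemma proj_zero: "x \<in> V\<^sup>\<bottom> \<Longrightarrow> \<pi> x = 0"
  by (rule orth_proj_eqI) (auto simp: sub subspace_0)

lemma proj_sym: "\<pi> x \<bullet> y = x \<bullet> \<pi> y"
  by (metis proj_in proj_inner proj_inner')

lemma proj_norm: "norm (\<pi> x) \<le> norm x"
proof -
  have "norm (\<pi> x) ^ 2 = x \<bullet> \<pi> x" by (simp add: power2_norm_eq_inner proj_inner)
  also have "\<dots> \<le> norm x * norm (\<pi> x)" by (rule norm_cauchy_schwarz)
  finally show ?thesis
    by (metis mult_right_le_imp_le norm_ge_zero order_le_less power2_eq_square)
qed

lemma proj_bounded_linear: "bounded_linear \<pi>"
proof (rule bounded_linear_intro[where K=1])
  show "\<pi> (x + y) = \<pi> x + \<pi> y" for x y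
  proof (rule orth_proj_eqI[OF sub])
    have "(x - \<pi> x) + (y - \<pi> y) \<in> V\<^sup>\<bottom>"
      by (intro subspace_add subspace_orthogonal_comp proj_perp)
    then show "x + y - (\<pi> x + \<pi> y) \<in> V\<^sup>\<bottom>" by (simp add: algebra_simps)
  qed (simp add: sub subspace_add)
  show "\<pi> (r *\<^sub>R x) = r *\<^sub>R \<pi> x" for r x
  proof (rule orth_proj_eqI[OF sub])
    have "r *\<^sub>R (x - \<pi> x) \<in> V\<^sup>\<bottom>"
      by (intro subspace_scale subspace_orthogonal_comp proj_perp)
    then show "r *\<^sub>R x - r *\<^sub>R \<pi> x \<in> V\<^sup>\<bottom>" by (simp add: algebra_simps)
  qed (simp add: sub subspace_scale)
qed (simp add: proj_norm)

lemma proj_linear: "linear \<pi>"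
  using proj_bounded_linear by (rule bounded_linear.linear)

lemma double_orth_comp: "V\<^sup>\<bottom>\<^sup>\<bottom> = V"
proof
  show "V\<^sup>\<bottom>\<^sup>\<bottom> \<subseteq> V"
  proof
    fix x assume x: "x \<in> V\<^sup>\<bottom>\<^sup>\<bottom>"
    have "x \<bullet> (x - \<pi> x) = 0" using x proj_perp[of x] unfolding orth_comp_iff[of x] by blast
    moreover have "\<pi> x \<bullet> (x - \<pi> x) = 0"
      using proj_perp[of x] by (auto simp: orth_comp_iff inner_commute)
    ultimately have "(x - \<pi> x) \<bullet> (x - \<pi> x) = 0" by (simp add: inner_diff_left)
    then show "x \<in> V" by (metis eq_iff_diff_eq_0 inner_eq_zero_iff proj_in)
  qed
qed (rule orthogonal_comp_subset)

end

section \<open>Finite-dimensional subspaces\<close>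

lemma finite_dimensional_basis:
  assumes "finite_dimensional S"
  obtains b where "b \<subseteq> S" "independent b" "finite b" "S \<subseteq> span b" "card b = dim S"
proof -
  obtain b where b: "b \<subseteq> S" "independent b" "S \<subseteq> span b" "card b = dim S"
    by (rule basis_exists)
  obtain F where F: "finite F" "S \<subseteq> span F" using assms unfolding finite_dimensional_def by blast
  have "finite b" using independent_span_bound[OF F(1) b(2)] b(1) F(2) by blast
  with b that show thesis by blast
qed

lemma finite_dimensional_subset: "finite_dimensional S \<Longrightarrow> T \<subseteq> S \<Longrightarrow> finite_dimensional T"
  unfolding finite_dimensional_def by blast

lemma dim_le_of_subset:
  assumes "finite_dimensional S" "T \<subseteq> S"
  shows "dim T \<le> dim S"
proof -
  obtain b where "finite b" "S \<subseteq> span b" "card b = dim S"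
    using finite_dimensional_basis[OF assms(1)] by metis
  then show ?thesis using dim_le_card[of T b] assms(2) by auto
qed

text \<open>
  A linear functional cuts the dimension by at most one. With finitely many functionals taken
  from a pairing, this single bound carries all dimension counts below.
\<close>

lemma dim_le_kernel_plus_one:
  assumes X: "subspace X" and f: "linear (f :: 'a::real_vector \<Rightarrow> real)"
    and fd: "finite_dimensional {x\<in>X. f x = 0}"
  shows "finite_dimensional X \<and> dim X \<le> dim {x\<in>X. f x = 0} + 1"
proof (cases "\<exists>a\<in>X. f a \<noteq> 0")
  case True
  then obtain a where a: "a \<in> X" "f a \<noteq> 0" by blast
  obtain b where b: "finite b" "{x\<in>X. f x = 0} \<subseteq> span b" "card b = dim {x\<in>X. f x = 0}"
    using finite_dimensional_basis[OF fd] by metis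
  have "X \<subseteq> span (insert a b)"
  proof
    fix x assume x: "x \<in> X"
    define y where "y = x - (f x / f a) *\<^sub>R a"
    have "y \<in> X" using x a X by (simp add: y_def subspace_diff subspace_scale)
    moreover have "f y = 0"
      using a by (simp add: y_def linear_diff[OF f] linear_scale[OF f])
    ultimately have "y \<in> span b" using b by blast
    then have "y \<in> span (insert a b)" using span_mono[of b "insert a b"] by blast
    moreover have "(f x / f a) *\<^sub>R a \<in> span (insert a b)"
      by (intro span_scale span_base) simp
    ultimately have "y + (f x / f a) *\<^sub>R a \<in> span (insert a b)" by (rule span_add)
    then show "x \<in> span (insert a b)" by (simp add: y_def)
  qed
  moreover have "finite (insert a b)" using b by simp
  ultimately have "finite_dimensional X" "dim X \<le> card (insert a b)"
    unfolding finite_dimensional_def using dim_le_card by blast+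
  moreover have "card (insert a b) \<le> card b + 1" using b(1) by (simp add: card_insert_if)
  ultimately show ?thesis using b by simp
next
  case False
  then have "{x\<in>X. f x = 0} = X" by auto
  then show ?thesis using fd by simp
qed

lemma dim_le_annihilator_plus_card:
  fixes b :: "'a::real_vector \<Rightarrow> 'b \<Rightarrow> real"
  assumes "subspace X" and lin: "\<And>g. linear (\<lambda>x. b x g)" and "finite G"
    and "finite_dimensional {x\<in>X. \<forall>g\<in>G. b x g = 0}"
  shows "finite_dimensional X \<and> dim X \<le> dim {x\<in>X. \<forall>g\<in>G. b x g = 0} + card G"
  using assms(3,1,4)
proof (induction G arbitrary: X rule: finite_induct)
  case (insert g G)
  let ?X = "{x\<in>X. b x g = 0}"
  have eq: "{x\<in>X. \<forall>h\<in>insert g G. b x h = 0} = {x\<in>?X. \<forall>h\<in>G. b x h = 0}" by auto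
  have sX: "subspace ?X"
    using insert.prems(1) linear_subspace_kernel[OF lin[of g]]
    by (simp add: subspace_def linear_0[OF lin] linear_add[OF lin] linear_scale[OF lin])
  have 1: "finite_dimensional ?X \<and> dim ?X \<le> dim {x\<in>?X. \<forall>h\<in>G. b x h = 0} + card G"
    using insert.IH[OF sX] insert.prems(2) unfolding eq by blast
  then have "finite_dimensional X \<and> dim X \<le> dim ?X + 1"
    using dim_le_kernel_plus_one[OF insert.prems(1) lin] by blast
  with 1 show ?case unfolding eq using insert.hyps by auto
qed simp

text \<open>
  For the component \<open>c\<close> of \<open>a\<close> orthogonal to \<open>X\<close>, a vector lies in the span if and only if it lies in \<open>X\<close> after its
  component along \<open>c\<close> is removed, which is a closed condition.
\<close>

lemma closed_span_insert:
  fixes X :: "'a::{real_inner, complete_space} set"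
  assumes "subspace X" "closed X"
  shows "closed (span (insert a X))"
proof -
  interpret closed_subspace X using assms by unfold_locales
  define c where "c = a - \<pi> a"
  have sX: "span X = X" using sub span_eq_iff by blast
  have sp: "span (insert a X) = {x + t *\<^sub>R c | x t. x \<in> X}"
  proof -
    show ?thesis
    proof (intro set_eqI iffI)
      fix y assume "y \<in> span (insert a X)"
      then obtain t where "y - t *\<^sub>R a \<in> X" using sX by (auto simp: span_insert)
      then have "(y - t *\<^sub>R a) + t *\<^sub>R \<pi> a \<in> X"
        using sub by (simp add: subspace_add subspace_scale)
      moreover have "y = ((y - t *\<^sub>R a) + t *\<^sub>R \<pi> a) + t *\<^sub>R c"
        by (simp add: c_def algebra_simps)
      ultimately show "y \<in> {x + t *\<^sub>R c | x t. x \<in> X}" by blast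
    next
      fix y assume "y \<in> {x + t *\<^sub>R c | x t. x \<in> X}"
      then obtain x t where y: "y = x + t *\<^sub>R c" "x \<in> X" by blast
      have "y - t *\<^sub>R a = x - t *\<^sub>R \<pi> a" by (simp add: y c_def algebra_simps)
      also have "\<dots> \<in> X" using sub y by (simp add: subspace_diff subspace_scale)
      finally have "y - t *\<^sub>R a \<in> span X" unfolding sX .
      then show "y \<in> span (insert a X)" unfolding span_insert by blast
    qed
  qed
  show ?thesis
  proof (cases "c = 0")
    case True
    then show ?thesis using clo sp by auto
  next
    case False
    have cX: "x \<bullet> c = 0" if "x \<in> X" for x
      using proj_perp[of a] that by (auto simp: c_def orth_comp_iff inner_commute)
    have "span (insert a X) = (\<lambda>x. x - ((x \<bullet> c) / (c \<bullet> c)) *\<^sub>R c) -` X"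
    proof (intro set_eqI iffI)
      fix y assume "y \<in> span (insert a X)"
      then obtain x t where y: "y = x + t *\<^sub>R c" "x \<in> X" using sp by blast
      then show "y \<in> (\<lambda>x. x - ((x \<bullet> c) / (c \<bullet> c)) *\<^sub>R c) -` X"
        using False cX by (simp add: inner_add_left)
    next
      fix y assume "y \<in> (\<lambda>x. x - ((x \<bullet> c) / (c \<bullet> c)) *\<^sub>R c) -` X"
      then have "y - ((y \<bullet> c) / (c \<bullet> c)) *\<^sub>R c \<in> X" by simp
      moreover have "y = (y - ((y \<bullet> c) / (c \<bullet> c)) *\<^sub>R c) + ((y \<bullet> c) / (c \<bullet> c)) *\<^sub>R c" by simp
      ultimately show "y \<in> span (insert a X)" unfolding sp by blast
    qed
    moreover have "closed ((\<lambda>x. x - ((x \<bullet> c) / (c \<bullet> c)) *\<^sub>R c) -` X)"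
      using False by (intro continuous_closed_vimage clo) (auto intro!: continuous_intros)
    ultimately show ?thesis by simp
  qed
qed

lemma closed_span_Un_finite:
  fixes X :: "'a::{real_inner, complete_space} set"
  assumes "finite F" "subspace X" "closed X"
  shows "closed (span (X \<union> F))"
  using assms(1)
proof (induction F rule: finite_induct)
  case empty
  have "span X = X" using assms(2) span_eq_iff by blast
  then show ?case using assms(3) by (simp only: Un_empty_right)
next
  case (insert a F)
  have "span (X \<union> insert a F) = span (insert a (span (X \<union> F)))"
    by (simp only: Un_insert_right span_insert[of a] span_span)
  then show ?case using closed_span_insert[OF subspace_span insert.IH, of a] by (simp only:)
qed

lemma closed_finite_dimensional:
  fixes X :: "'a::{real_inner, complete_space} set"
  assumes "subspace X" "finite_dimensional X"
  shows "closed X"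
proof -
  obtain b where b: "b \<subseteq> X" "finite b" "X \<subseteq> span b"
    using finite_dimensional_basis[OF assms(2)] by metis
  have "X = span b" using b assms(1) span_minimal by blast
  moreover have "span ({0} \<union> b) = span b" by (simp only: insert_is_Un[symmetric] span_insert_0)
  moreover have "closed (span ({0} \<union> b))"
    by (rule closed_span_Un_finite[OF b(2) subspace_single_0]) simp
  ultimately show ?thesis by metis
qed

section \<open>Compact operators\<close>

text \<open>
  In terms of finite nets, the closure of the class of compact operators under sums, compositions and
  norm limits is elementary.
\<close>

lemma compact_operator_iff_totally_bounded:
  fixes K :: "'a::real_normed_vector \<Rightarrow> 'b::{real_normed_vector, complete_space}"
  shows "compact_operator K \<longleftrightarrow> bounded_linear K \<and>
    (\<forall>e>0. \<exists>F. finite F \<and> (\<forall>x. norm x \<le> 1 \<longrightarrow> (\<exists>y\<in>F. norm (K x - y) \<le> e)))"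
proof -
  have "compact (closure (K ` cball 0 1)) \<longleftrightarrow>
    (\<forall>e>0. \<exists>F. finite F \<and> (\<forall>x. norm x \<le> 1 \<longrightarrow> (\<exists>y\<in>F. norm (K x - y) \<le> e)))" (is "?L \<longleftrightarrow> ?R")
  proof
    assume L: ?L
    show ?R
    proof (intro allI impI)
      fix e :: real assume "e > 0"
      then obtain F where F: "finite F" "closure (K ` cball 0 1) \<subseteq> (\<Union>x\<in>F. ball x e)"
        using L unfolding compact_eq_totally_bounded by blast
      have "\<exists>y\<in>F. norm (K x - y) \<le> e" if "norm x \<le> 1" for x
      proof -
        have "K x \<in> closure (K ` cball 0 1)"
          using that closure_subset by force
        then obtain y where "y \<in> F" "K x \<in> ball y e" using F(2) by blast
        then show ?thesis by (auto simp: dist_norm norm_minus_commute intro!: bexI[of _ y])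
      qed
      with F(1) show "\<exists>F. finite F \<and> (\<forall>x. norm x \<le> 1 \<longrightarrow> (\<exists>y\<in>F. norm (K x - y) \<le> e))" by blast
    qed
  next
    assume R: ?R
    have "\<exists>F. finite F \<and> closure (K ` cball 0 1) \<subseteq> (\<Union>x\<in>F. ball x e)" if e: "e > 0" for e
    proof -
      obtain F where F: "finite F" "\<And>x. norm x \<le> 1 \<Longrightarrow> \<exists>y\<in>F. norm (K x - y) \<le> e / 2"
        using R e by (metis half_gt_zero)
      have "K ` cball 0 1 \<subseteq> (\<Union>y\<in>F. cball y (e / 2))"
        using F(2) by (force simp: dist_norm norm_minus_commute)
      then have "closure (K ` cball 0 1) \<subseteq> (\<Union>y\<in>F. cball y (e / 2))"
        by (rule closure_minimal) (use F(1) in \<open>auto intro!: closed_UN\<close>)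
      also have "\<dots> \<subseteq> (\<Union>y\<in>F. ball y e)" using e by fastforce
      finally show ?thesis using F(1) by blast
    qed
    then show ?L unfolding compact_eq_totally_bounded by (simp add: complete_eq_closed)
  qed
  then show ?thesis unfolding compact_operator_def by blast
qed

lemma compact_operator_bounded_linear: "compact_operator K \<Longrightarrow> bounded_linear K"
  by (simp add: compact_operator_def)

lemma compact_operator_add:
  fixes K L :: "'a::real_normed_vector \<Rightarrow> 'b::{real_normed_vector, complete_space}"
  assumes "compact_operator K" "compact_operator L"
  shows "compact_operator (\<lambda>x. K x + L x)"
  unfolding compact_operator_iff_totally_bounded
proof (intro conjI allI impI)
  show "bounded_linear (\<lambda>x. K x + L x)"
    using assms by (intro bounded_linear_add compact_operator_bounded_linear)
  fix e :: real assume "e > 0"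
  then have e: "e / 2 > 0" by simp
  obtain F where F: "finite F" "\<And>x. norm x \<le> 1 \<Longrightarrow> \<exists>y\<in>F. norm (K x - y) \<le> e / 2"
    using assms(1) e unfolding compact_operator_iff_totally_bounded by meson
  obtain G where G: "finite G" "\<And>x. norm x \<le> 1 \<Longrightarrow> \<exists>y\<in>G. norm (L x - y) \<le> e / 2"
    using assms(2) e unfolding compact_operator_iff_totally_bounded by meson
  have "\<exists>w\<in>(\<lambda>(y, z). y + z) ` (F \<times> G). norm (K x + L x - w) \<le> e" if x: "norm x \<le> 1" for x
  proof -
    obtain y z where yz: "y \<in> F" "norm (K x - y) \<le> e / 2" "z \<in> G" "norm (L x - z) \<le> e / 2"
      using F(2)[OF x] G(2)[OF x] by blast
    have "norm (K x + L x - (y + z)) \<le> norm (K x - y) + norm (L x - z)"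
      using norm_triangle_ineq[of "K x - y" "L x - z"] by (simp add: algebra_simps)
    then have "norm (K x + L x - (y + z)) \<le> e" using yz by simp
    moreover have "y + z \<in> (\<lambda>(y, z). y + z) ` (F \<times> G)" using yz by force
    ultimately show ?thesis by blast
  qed
  then show "\<exists>F. finite F \<and> (\<forall>x. norm x \<le> 1 \<longrightarrow> (\<exists>y\<in>F. norm (K x + L x - y) \<le> e))"
    using F(1) G(1) by (intro exI[of _ "(\<lambda>(y, z). y + z) ` (F \<times> G)"]) simp
qed

lemma compact_operator_compose_left:
  fixes K :: "'a::real_normed_vector \<Rightarrow> 'b::{real_normed_vector, complete_space}"
    and A :: "'b \<Rightarrow> 'c::{real_normed_vector, complete_space}"
  assumes K: "compact_operator K" and A: "bounded_linear A"
  shows "compact_operator (\<lambda>x. A (K x))"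
  unfolding compact_operator_iff_totally_bounded
proof (intro conjI allI impI)
  show "bounded_linear (\<lambda>x. A (K x))"
    using A compact_operator_bounded_linear[OF K] by (rule bounded_linear_compose)
  fix e :: real assume "e > 0"
  obtain c where c: "c > 0" "\<And>x. norm (A x) \<le> norm x * c"
    using bounded_linear.pos_bounded[OF A] by blast
  have "e / c > 0" using c \<open>e > 0\<close> by simp
  then obtain F where F: "finite F" "\<And>x. norm x \<le> 1 \<Longrightarrow> \<exists>y\<in>F. norm (K x - y) \<le> e / c"
    using K unfolding compact_operator_iff_totally_bounded by meson
  have "\<exists>w\<in>A ` F. norm (A (K x) - w) \<le> e" if x: "norm x \<le> 1" for x
  proof -
    obtain y where y: "y \<in> F" "norm (K x - y) \<le> e / c" using F(2)[OF x] by blast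
    have "norm (A (K x) - A y) = norm (A (K x - y))"
      using A by (simp add: linear_diff bounded_linear.linear)
    also have "\<dots> \<le> norm (K x - y) * c" by (rule c)
    also have "\<dots> \<le> e" using y c by (simp add: pos_le_divide_eq)
    finally show ?thesis using y by blast
  qed
  then show "\<exists>F. finite F \<and> (\<forall>x. norm x \<le> 1 \<longrightarrow> (\<exists>y\<in>F. norm (A (K x) - y) \<le> e))"
    using F(1) by (intro exI[of _ "A ` F"]) simp
qed

lemma compact_operator_compose_right:
  fixes K :: "'b::real_normed_vector \<Rightarrow> 'c::{real_normed_vector, complete_space}"
    and A :: "'a::real_normed_vector \<Rightarrow> 'b"
  assumes K: "compact_operator K" and A: "bounded_linear A"
  shows "compact_operator (\<lambda>x. K (A x))"
  unfolding compact_operator_iff_totally_bounded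
proof (intro conjI allI impI)
  have bK: "bounded_linear K" by (rule compact_operator_bounded_linear[OF K])
  show "bounded_linear (\<lambda>x. K (A x))"
    using bK A by (rule bounded_linear_compose)
  fix e :: real assume "e > 0"
  obtain c where c: "c > 0" "\<And>x. norm (A x) \<le> norm x * c"
    using bounded_linear.pos_bounded[OF A] by blast
  have "e / c > 0" using c \<open>e > 0\<close> by simp
  then obtain F where F: "finite F" "\<And>x. norm x \<le> 1 \<Longrightarrow> \<exists>y\<in>F. norm (K x - y) \<le> e / c"
    using K unfolding compact_operator_iff_totally_bounded by meson
  have "\<exists>w\<in>(*\<^sub>R) c ` F. norm (K (A x) - w) \<le> e" if x: "norm x \<le> 1" for x
  proof -
    define u where "u = inverse c *\<^sub>R A x"
    have "norm (A x) \<le> c"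
      using c(2)[of x] mult_right_mono[OF x, of c] c(1) by linarith
    then have "norm u \<le> 1" using c(1) by (simp add: u_def divide_simps)
    then obtain y where y: "y \<in> F" "norm (K u - y) \<le> e / c" using F(2) by blast
    have "A x = c *\<^sub>R u" using c(1) by (simp add: u_def)
    then have "K (A x) - c *\<^sub>R y = c *\<^sub>R (K u - y)"
      using bK by (simp add: linear_scale bounded_linear.linear algebra_simps)
    then have "norm (K (A x) - c *\<^sub>R y) = c * norm (K u - y)" using c(1) by simp
    also have "\<dots> \<le> e" using y c by (simp add: pos_le_divide_eq mult.commute)
    finally show ?thesis using y by blast
  qed
  then show "\<exists>F. finite F \<and> (\<forall>x. norm x \<le> 1 \<longrightarrow> (\<exists>y\<in>F. norm (K (A x) - y) \<le> e))"
    using F(1) by (intro exI[of _ "(*\<^sub>R) c ` F"]) simp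
qed

lemma compact_operator_scaleR:
  fixes K :: "'a::real_normed_vector \<Rightarrow> 'b::{real_normed_vector, complete_space}"
  shows "compact_operator K \<Longrightarrow> compact_operator (\<lambda>x. r *\<^sub>R K x)"
  by (rule compact_operator_compose_left[OF _ bounded_linear_scaleR_right])

lemma compact_operator_diff:
  fixes K L :: "'a::real_normed_vector \<Rightarrow> 'b::{real_normed_vector, complete_space}"
  assumes "compact_operator K" "compact_operator L"
  shows "compact_operator (\<lambda>x. K x - L x)"
  using compact_operator_add[OF assms(1) compact_operator_scaleR[OF assms(2), of "-1"]] by simp

lemma compact_operator_zero:
  "compact_operator (\<lambda>x::'a::real_normed_vector. 0 :: 'b::{real_normed_vector, complete_space})"
  unfolding compact_operator_iff_totally_bounded
  by (auto intro!: exI[of _ "{0}"])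

lemma compact_operator_limit:
  fixes K :: "'a::real_normed_vector \<Rightarrow> 'b::{real_normed_vector, complete_space}"
  assumes K: "bounded_linear K"
    and approx: "\<And>e. e > 0 \<Longrightarrow> \<exists>L. compact_operator L \<and> (\<forall>x. norm (K x - L x) \<le> e * norm x)"
  shows "compact_operator K"
  unfolding compact_operator_iff_totally_bounded
proof (intro conjI allI impI K)
  fix e :: real assume "e > 0"
  then have e: "e / 2 > 0" by simp
  obtain L where L: "compact_operator L" "\<And>x. norm (K x - L x) \<le> (e / 2) * norm x"
    using approx[OF e] by blast
  obtain F where F: "finite F" "\<And>x. norm x \<le> 1 \<Longrightarrow> \<exists>y\<in>F. norm (L x - y) \<le> e / 2"
    using L(1) e unfolding compact_operator_iff_totally_bounded by meson
  have "\<exists>y\<in>F. norm (K x - y) \<le> e" if x: "norm x \<le> 1" for x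
  proof -
    obtain y where y: "y \<in> F" "norm (L x - y) \<le> e / 2" using F(2)[OF x] by blast
    have "(e / 2) * norm x \<le> e / 2" using x e by (simp add: mult_left_le)
    then have "norm (K x - L x) \<le> e / 2" using L(2)[of x] by linarith
    then have "norm (K x - y) \<le> e"
      using norm_triangle_ineq[of "K x - L x" "L x - y"] y by simp
    then show ?thesis using y by blast
  qed
  then show "\<exists>F. finite F \<and> (\<forall>x. norm x \<le> 1 \<longrightarrow> (\<exists>y\<in>F. norm (K x - y) \<le> e))"
    using F(1) by blast
qed

text \<open>
  An operator \<open>X\<close> that solves an equation \<open>X = F + \<Phi> X\<close> with compact \<open>F\<close> and a contraction \<open>\<Phi>\<close> that
  preserves compactness is compact: \<open>\<Phi>\<close> turns a compact approximation of \<open>X\<close> into one that is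
  better by the factor \<open>q\<close>. The hypothesis \<open>improve\<close> asks for just this improvement.
\<close>

lemma compact_operator_if_contractive:
  fixes X :: "'a::real_normed_vector \<Rightarrow> 'b::{real_normed_vector, complete_space}"
  assumes X: "bounded_linear X" and q: "0 \<le> q" "q < 1"
    and improve: "\<And>L d. compact_operator L \<Longrightarrow> 0 \<le> d \<Longrightarrow> (\<And>x. norm (X x - L x) \<le> d * norm x)
      \<Longrightarrow> \<exists>L'. compact_operator L' \<and> (\<forall>x. norm (X x - L' x) \<le> q * d * norm x)"
  shows "compact_operator X"
proof (rule compact_operator_limit[OF X])
  fix e :: real assume e: "e > 0"
  obtain c where c: "c > 0" "\<And>x. norm (X x) \<le> norm x * c"
    using bounded_linear.pos_bounded[OF X] by blast
  have step: "\<exists>L. compact_operator L \<and> (\<forall>x. norm (X x - L x) \<le> q ^ n * c * norm x)" for n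
  proof (induction n)
    case 0
    show ?case
      using c(2) by (intro exI[of _ "\<lambda>x. 0"]) (simp add: compact_operator_zero mult.commute)
  next
    case (Suc n)
    then obtain L where "compact_operator L" "\<And>x. norm (X x - L x) \<le> q ^ n * c * norm x" by blast
    moreover have "0 \<le> q ^ n * c" using q(1) c(1) by simp
    ultimately have "\<exists>L'. compact_operator L' \<and> (\<forall>x. norm (X x - L' x) \<le> q * (q ^ n * c) * norm x)"
      using improve by blast
    then show ?case by (simp add: mult.assoc)
  qed
  obtain n where "q ^ n < e / c"
    using real_arch_pow_inv[of "e / c" q] q e c(1) by auto
  then have n: "q ^ n * c \<le> e" using c(1) by (simp add: pos_less_divide_eq)
  obtain L where L: "compact_operator L" "\<And>x. norm (X x - L x) \<le> q ^ n * c * norm x"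
    using step by blast
  have "norm (X x - L x) \<le> e * norm x" for x
    using L(2)[of x] mult_right_mono[OF n norm_ge_zero[of x]] by linarith
  then show "\<exists>L. compact_operator L \<and> (\<forall>x. norm (X x - L x) \<le> e * norm x)" using L(1) by blast
qed

lemma compact_operator_rank_one:
  fixes c :: "'a::{real_inner, complete_space}" and d :: "'b::{real_normed_vector, complete_space}"
  shows "compact_operator (\<lambda>x. (x \<bullet> c) *\<^sub>R d)"
proof -
  let ?K = "\<lambda>x. (x \<bullet> c) *\<^sub>R d"
  have "bounded_linear ?K"
    by (intro bounded_linear_scaleR_const bounded_linear_inner_left)
  moreover have "compact (closure (?K ` cball 0 1))"
  proof -
    have C: "compact ((\<lambda>t. t *\<^sub>R d) ` {- norm c..norm c})"
      by (intro compact_continuous_image continuous_intros) simp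
    have "x \<bullet> c \<in> {- norm c..norm c}" if "norm x \<le> 1" for x
    proof -
      have "\<bar>x \<bullet> c\<bar> \<le> norm x * norm c" by (rule Cauchy_Schwarz_ineq2)
      also have "\<dots> \<le> norm c" using mult_right_mono[OF that norm_ge_zero[of c]] by simp
      finally show ?thesis by auto
    qed
    then have "?K ` cball 0 1 \<subseteq> (\<lambda>t. t *\<^sub>R d) ` {- norm c..norm c}"
      by auto
    then have "closure (?K ` cball 0 1) \<subseteq> (\<lambda>t. t *\<^sub>R d) ` {- norm c..norm c}"
      using C compact_imp_closed closure_minimal by blast
    then show ?thesis using compact_Int_closed[OF C closed_closure] by (metis inf.absorb_iff2)
  qed
  ultimately show ?thesis unfolding compact_operator_def by blast
qed

text \<open>
  A further vector \<open>a\<close> changes the projection by an operator of rank one, along the component of \<open>a\<close>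
  orthogonal to the span so far.
\<close>

lemma compact_operator_proj_span:
  fixes b :: "'a::{real_inner, complete_space} set"
  assumes "finite b"
  shows "compact_operator (orth_proj (span b))"
  using assms
proof (induction b rule: finite_induct)
  case empty
  have "orth_proj (span {}) = (\<lambda>x::'a. 0)"
    by (auto intro!: orth_proj_eqI ext simp: orth_comp_iff)
  then show ?case by (simp add: compact_operator_zero)
next
  case (insert a b)
  have fd: "finite_dimensional (span b)" if "finite b" for b :: "'a set"
    using that unfolding finite_dimensional_def by blast
  interpret S: closed_subspace "span b"
    using closed_finite_dimensional[OF subspace_span fd] insert.hyps
    by unfold_locales auto
  define c where "c = a - S.\<pi> a"
  have cb: "x \<bullet> c = 0" if "x \<in> span b" for x
    using S.proj_perp[of a] that by (auto simp: c_def orth_comp_iff inner_commute)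
  have mono: "S.\<pi> x \<in> span (insert a b)" for x
    using subsetD[OF span_mono[OF subset_insertI] S.proj_in] .
  have c_in: "c \<in> span (insert a b)"
    unfolding c_def by (intro span_diff mono span_base insertI1)
  have "orth_proj (span (insert a b)) x = S.\<pi> x + (x \<bullet> c) *\<^sub>R (inverse (c \<bullet> c) *\<^sub>R c)" for x
  proof (rule orth_proj_eqI[OF subspace_span])
    let ?p = "S.\<pi> x + (x \<bullet> c) *\<^sub>R (inverse (c \<bullet> c) *\<^sub>R c)"
    show "?p \<in> span (insert a b)"
      by (intro span_add span_scale c_in mono)
    have 1: "(x - ?p) \<bullet> y = 0" if "y \<in> span b" for y
      using cb[OF that] S.proj_inner[OF that, of x] by (simp add: inner_simps inner_commute)
    have 2: "(x - ?p) \<bullet> c = 0"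
      using cb[OF S.proj_in, of x] by (cases "c = 0") (simp_all add: inner_simps)
    have 3: "(x - ?p) \<bullet> a = 0"
      using 1[OF S.proj_in, of a] 2 by (simp add: c_def inner_diff_right)
    have "(x - ?p) \<bullet> y = 0" if "y \<in> span (insert a b)" for y
    proof -
      obtain k where "y - k *\<^sub>R a \<in> span b" using \<open>y \<in> span (insert a b)\<close> unfolding span_insert by blast
      from 1[OF this] 3 show ?thesis by (simp add: inner_diff_right)
    qed
    then show "x - ?p \<in> (span (insert a b))\<^sup>\<bottom>" by (auto simp: orth_comp_iff)
  qed
  then have "orth_proj (span (insert a b)) =
      (\<lambda>x. S.\<pi> x + (x \<bullet> c) *\<^sub>R (inverse (c \<bullet> c) *\<^sub>R c))" by blast
  then show ?case
    using compact_operator_add[OF insert.IH compact_operator_rank_one] by (simp only:)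
qed

lemma compact_operator_proj:
  fixes S :: "'a::{real_inner, complete_space} set"
  assumes "subspace S" "finite_dimensional S"
  shows "compact_operator (orth_proj S)"
proof -
  obtain b where b: "b \<subseteq> S" "finite b" "S \<subseteq> span b"
    using finite_dimensional_basis[OF assms(2)] by metis
  have S: "S = span b" using b assms(1) span_minimal by blast
  show ?thesis unfolding S by (rule compact_operator_proj_span[OF b(2)])
qed

section \<open>Symmetric operators with closed range\<close>

text \<open>
  The uniform boundedness principle for functionals on a Hilbert space. By the Baire category theorem, one
  of the closed sets \<open>C n\<close> of points where all functionals are at most \<open>n\<close> contains a ball.
\<close>

lemma pointwise_bounded_imp_bounded:
  fixes S :: "'a::{real_inner, complete_space} set"
  assumes "\<And>z. \<exists>k. \<forall>y\<in>S. \<bar>y \<bullet> z\<bar> \<le> k"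
  shows "\<exists>K. \<forall>y\<in>S. norm y \<le> K"
proof -
  define C where "C n = {z. \<forall>y\<in>S. \<bar>y \<bullet> z\<bar> \<le> real n}" for n
  have clC: "closed (C n)" for n
  proof -
    have "C n = (\<Inter>y\<in>S. {z. \<bar>y \<bullet> z\<bar> \<le> real n})" by (auto simp: C_def)
    then show ?thesis by (auto intro!: closed_INT closed_Collect_le continuous_intros)
  qed
  have "(\<Union>(range C)) = UNIV"
  proof -
    have "\<exists>n. z \<in> C n" for z
    proof -
      obtain k where k: "\<forall>y\<in>S. \<bar>y \<bullet> z\<bar> \<le> k" using assms by blast
      obtain n where "k \<le> real n" using real_arch_simple by blast
      then have "z \<in> C n" using k unfolding C_def by force
      then show ?thesis by blast
    qed
    then show ?thesis by blast
  qed
  then have "interior (\<Union>(range C)) \<noteq> {}" by simp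
  then obtain n where "interior (C n) \<noteq> {}"
    using Baire_category_alt[of "euclidean :: 'a topology" "range C"] clC
    by (auto simp: completely_metrizable_space_euclidean)
  then obtain z0 e where e: "e > 0" "ball z0 e \<subseteq> C n"
    unfolding mem_interior by (metis ex_in_conv mem_interior)
  have "norm y \<le> 4 * real n / e" if y: "y \<in> S" for y
  proof (cases "y = 0")
    case False
    define h where "h = (e / (2 * norm y)) *\<^sub>R y"
    have "norm h = e / 2" using False e by (simp add: h_def)
    then have "z0 + h \<in> C n" "z0 \<in> C n" using e by (auto simp: dist_norm)
    then have "\<bar>y \<bullet> (z0 + h)\<bar> \<le> real n" "\<bar>y \<bullet> z0\<bar> \<le> real n" using y by (auto simp: C_def)
    then have "y \<bullet> h \<le> 2 * real n" by (simp add: inner_add_right)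
    moreover have "y \<bullet> h = e / 2 * norm y"
      using False by (simp add: h_def power2_norm_eq_inner[symmetric] power2_eq_square)
    ultimately show ?thesis using e(1) by (simp add: field_simps)
  qed (use e in auto)
  then show ?thesis by blast
qed

lemma semidefinite_Cauchy_Schwarz:
  fixes E :: "'a::real_inner \<Rightarrow> 'a"
  assumes E: "linear E" and sym: "\<And>x y. E x \<bullet> y = x \<bullet> E y"
    and S: "subspace S" and nn: "\<And>z. z \<in> S \<Longrightarrow> 0 \<le> E z \<bullet> z"
    and x: "x \<in> S" and y: "y \<in> S"
  shows "(E x \<bullet> y)\<^sup>2 \<le> (E x \<bullet> x) * (E y \<bullet> y)"
proof -
  have ex: "E (s *\<^sub>R x + t *\<^sub>R y) \<bullet> (s *\<^sub>R x + t *\<^sub>R y) =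
      s\<^sup>2 * (E x \<bullet> x) + 2 * (s * t) * (E x \<bullet> y) + t\<^sup>2 * (E y \<bullet> y)" for s t
    using sym[of y x]
    by (simp add: linear_add[OF E] linear_scale[OF E] inner_add_left inner_add_right inner_commute
        power2_eq_square algebra_simps)
  have pos: "0 \<le> s\<^sup>2 * (E x \<bullet> x) + 2 * (s * t) * (E x \<bullet> y) + t\<^sup>2 * (E y \<bullet> y)" for s t
    using nn[of "s *\<^sub>R x + t *\<^sub>R y"] x y S by (simp only: ex subspace_add subspace_scale)
  show ?thesis
  proof (cases "E y \<bullet> y = 0")
    case True
    have "E x \<bullet> y = 0"
    proof (rule ccontr)
      assume ne: "E x \<bullet> y \<noteq> 0"
      show False
        using pos[of 1 "- (E x \<bullet> x + 1) / (2 * (E x \<bullet> y))"] ne True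
          by (simp add: field_simps)
    qed
    then show ?thesis using True by simp
  next
    case False
    then have p: "E y \<bullet> y > 0" using nn[OF y] by simp
    have "0 \<le> (E y \<bullet> y) * ((E x \<bullet> x) * (E y \<bullet> y) - (E x \<bullet> y)\<^sup>2)"
      using pos[of "E y \<bullet> y" "- (E x \<bullet> y)"] by (simp add: power2_eq_square algebra_simps)
    then show ?thesis using p by (simp add: zero_le_mult_iff)
  qed
qed

text \<open>
  For a positive operator the quadratic form controls the norm: apply the Cauchy-Schwarz inequality of
  the form to \<open>x\<close> and \<open>E x\<close>.
\<close>

lemma symmetric_norm_bound:
  fixes E :: "'a::real_inner \<Rightarrow> 'a"
  assumes E: "linear E" and sym: "\<And>x y. E x \<bullet> y = x \<bullet> E y" and q: "0 \<le> q"
    and nn: "\<And>z. 0 \<le> E z \<bullet> z" and ub: "\<And>z. E z \<bullet> z \<le> q * (norm z)\<^sup>2"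
  shows "norm (E x) \<le> q * norm x"
proof (cases "E x = 0")
  case False
  have "(norm (E x))\<^sup>2 * (norm (E x))\<^sup>2 = (E x \<bullet> E x)\<^sup>2"
    by (simp only: power2_norm_eq_inner power2_eq_square[of "E x \<bullet> E x"])
  also have "\<dots> \<le> (E x \<bullet> x) * (E (E x) \<bullet> E x)"
    by (rule semidefinite_Cauchy_Schwarz[OF E sym subspace_UNIV nn]) auto
  also have "\<dots> \<le> (q * (norm x)\<^sup>2) * (q * (norm (E x))\<^sup>2)"
    by (intro mult_mono ub nn) (use q in auto)
  also have "\<dots> = (q * norm x)\<^sup>2 * (norm (E x))\<^sup>2" by (simp add: power2_eq_square)
  finally have "(norm (E x))\<^sup>2 \<le> (q * norm x)\<^sup>2"
    by (rule mult_right_le_imp_le) (use False in simp)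
  then show ?thesis by (rule power2_le_imp_le) (use q in simp)
qed (use q in simp)

locale symmetric_closed_range =
  fixes T :: "'a::{real_inner, complete_space} \<Rightarrow> 'a"
  assumes bl: "bounded_linear T" and sym: "\<And>x y. T x \<bullet> y = x \<bullet> T y"
    and closed_range: "closed (range T)"
begin

abbreviation "Ker \<equiv> {x. T x = 0}"

lemma lin: "linear T" using bl by (rule bounded_linear.linear)

lemma closed_subspace_ker: "closed_subspace Ker"
proof
  show "subspace Ker" using linear_subspace_kernel[OF lin] .
  show "closed Ker"
    by (intro closed_Collect_eq linear_continuous_on bl continuous_on_const)
qed

lemma closed_subspace_range: "closed_subspace (range T)"
  using closed_range linear_subspace_image[OF lin subspace_UNIV] by unfold_locales

lemma range_eq: "range T = Ker\<^sup>\<bottom>"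
proof -
  have "(range T)\<^sup>\<bottom> = Ker"
  proof (intro set_eqI iffI)
    fix x assume "x \<in> (range T)\<^sup>\<bottom>"
    then have "x \<bullet> T (T x) = 0" unfolding orth_comp_iff by blast
    then have "T x \<bullet> T x = 0" using sym[of x "T x"] by simp
    then show "x \<in> Ker" by simp
  next
    fix x assume "x \<in> Ker"
    then have "x \<bullet> T y = 0" for y using sym[of x y] by simp
    then show "x \<in> (range T)\<^sup>\<bottom>" by (auto simp: orth_comp_iff)
  qed
  then show ?thesis using closed_subspace.double_orth_comp[OF closed_subspace_range] by metis
qed

text \<open>
  The vectors \<open>x\<close> orthogonal to the kernel with \<open>\<parallel>T x\<parallel> \<le> 1\<close> are weakly bounded, because every vector
  is \<open>T w\<close> up to the kernel. Hence they are bounded in norm.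
\<close>

lemma bounded_below: "\<exists>c>0. \<forall>x\<in>Ker\<^sup>\<bottom>. c * norm x \<le> norm (T x)"
proof -
  let ?S = "{x \<in> Ker\<^sup>\<bottom>. norm (T x) \<le> 1}"
  have "\<exists>k. \<forall>x\<in>?S. \<bar>x \<bullet> z\<bar> \<le> k" for z
  proof -
    interpret R: closed_subspace "range T" by (rule closed_subspace_range)
    obtain w where w: "orth_proj (range T) z = T w" using R.proj_in[of z] by blast
    have "\<bar>x \<bullet> z\<bar> \<le> norm w" if x: "x \<in> ?S" for x
    proof -
      have "x \<in> range T" using x range_eq by blast
      then have "x \<bullet> z = T x \<bullet> w" using R.proj_inner'[of x z] w sym by simp
      also have "\<bar>\<dots>\<bar> \<le> norm (T x) * norm w" by (rule Cauchy_Schwarz_ineq2)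
      also have "\<dots> \<le> norm w" using x mult_right_mono[of "norm (T x)" 1 "norm w"] by simp
      finally show ?thesis .
    qed
    then show ?thesis by blast
  qed
  then obtain K where K: "\<And>x. x \<in> ?S \<Longrightarrow> norm x \<le> K"
    using pointwise_bounded_imp_bounded[of ?S] by blast
  have "norm x \<le> (\<bar>K\<bar> + 1) * norm (T x)" if x: "x \<in> Ker\<^sup>\<bottom>" for x
  proof (cases "T x = 0")
    case True
    then have "x \<bullet> x = 0" using x unfolding orth_comp_iff by blast
    then show ?thesis by simp
  next
    case False
    let ?y = "inverse (norm (T x)) *\<^sub>R x"
    have "?y \<in> ?S"
      using x False by (simp add: subspace_scale subspace_orthogonal_comp linear_scale[OF lin])
    from K[OF this] have "norm x \<le> K * norm (T x)"
      using False by (simp add: divide_simps mult.commute)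
    also have "\<dots> \<le> (\<bar>K\<bar> + 1) * norm (T x)" by (intro mult_right_mono) auto
    finally show ?thesis .
  qed
  then show ?thesis
    by (intro exI[of _ "inverse (\<bar>K\<bar> + 1)"]) (auto simp: field_simps)
qed

end

section \<open>The sign of a symmetric operator\<close>

text \<open>
  \<open>J\<close> is the sign of the invertible symmetric operator \<open>U\<close>, and \<open>Y = 1 - \<bar>U\<bar>\<close> where \<open>\<bar>U\<bar>\<close> is the positive square root of
  \<open>U\<^sup>2\<close>: \<open>eqY\<close> says \<open>(1 - Y)\<^sup>2 = U\<^sup>2\<close>, \<open>normY\<close> makes \<open>1 - Y\<close> at least \<open>g\<close>, and
  \<open>eqJ\<close> says \<open>(1 - Y) J = U\<close>. Working with \<open>Y\<close> and not with \<open>\<bar>U\<bar>\<close> keeps the contractions visible.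
\<close>

locale operator_sign =
  fixes g :: real and U Y J :: "'a::{real_inner, complete_space} \<Rightarrow> 'a"
  assumes g_pos: "0 < g" and g_le: "g \<le> 1"
    and blU: "bounded_linear U" and blY: "bounded_linear Y" and blJ: "bounded_linear J"
    and normY: "norm (Y x) \<le> (1 - g) * norm x"
    and eqY: "2 *\<^sub>R Y x = x - U (U x) + Y (Y x)"
    and YU: "Y (U x) = U (Y x)"
    and Y_invariant: "\<lbrakk>subspace W; closed W; U ` W \<subseteq> W\<rbrakk> \<Longrightarrow> Y ` W \<subseteq> W"
    and eqJ: "J x = U x + Y (J x)"
    and symJ: "J x \<bullet> y = x \<bullet> J y"
    and JU: "J (U x) = U (J x)"
    and JJ: "J (J x) = x"

text \<open>
  The Banach fixed point theorem for operators. The contraction is measured in the operator norm; closedness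
  of \<open>S\<close> refers to pointwise limits, under which the algebraic conditions imposed below
  are visibly stable.
\<close>

lemma operator_fixed_point:
  fixes \<Phi> :: "('a::real_normed_vector \<Rightarrow> 'b::{real_normed_vector, complete_space}) \<Rightarrow> 'a \<Rightarrow> 'b"
  assumes r: "0 \<le> r" "r < 1" and y0: "y0 \<in> S" and \<Phi>: "\<And>y. y \<in> S \<Longrightarrow> \<Phi> y \<in> S"
    and c: "0 \<le> c" "\<And>x. norm (\<Phi> y0 x - y0 x) \<le> c * norm x"
    and lipschitz: "\<And>y z d x. \<lbrakk>y \<in> S; z \<in> S; 0 \<le> d; \<And>x. norm (y x - z x) \<le> d * norm x\<rbrakk>
      \<Longrightarrow> norm (\<Phi> y x - \<Phi> z x) \<le> r * d * norm x"
    and limit: "\<And>y l. \<lbrakk>\<And>n::nat. y n \<in> S; \<And>x. (\<lambda>n. y n x) \<longlonglongrightarrow> l x\<rbrakk> \<Longrightarrow> l \<in> S"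
  shows "\<exists>y\<in>S. \<Phi> y = y"
proof -
  define y where "y n = (\<Phi> ^^ n) y0" for n
  have y_Suc: "y (Suc n) = \<Phi> (y n)" for n by (simp add: y_def)
  have yS: "y n \<in> S" for n
    by (induction n) (simp_all add: y_Suc \<Phi>, simp add: y_def y0)
  have step: "norm (y (Suc n) x - y n x) \<le> r ^ n * c * norm x" for n x
  proof (induction n arbitrary: x)
    case 0
    show ?case using c(2) by (simp add: y_def)
  next
    case (Suc n)
    have "norm (\<Phi> (y (Suc n)) x - \<Phi> (y n) x) \<le> r * (r ^ n * c) * norm x"
      by (rule lipschitz) (use yS Suc r c(1) in auto)
    then show ?case by (simp add: y_Suc mult.assoc)
  qed
  define D where "D = c / (1 - r)"
  have D: "0 \<le> D" "c = D * (1 - r)" using r c(1) by (auto simp: D_def)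
  have far: "norm (y (n + m) x - y n x) \<le> r ^ n * (1 - r ^ m) * D * norm x" for n m x
  proof (induction m)
    case (Suc m)
    have "norm (y (n + Suc m) x - y n x)
        \<le> norm (y (Suc (n + m)) x - y (n + m) x) + norm (y (n + m) x - y n x)"
      using norm_triangle_ineq[of "y (Suc (n + m)) x - y (n + m) x" "y (n + m) x - y n x"] by simp
    also have "\<dots> \<le> r ^ (n + m) * c * norm x + r ^ n * (1 - r ^ m) * D * norm x"
      by (intro add_mono step Suc)
    also have "\<dots> = r ^ n * (1 - r ^ Suc m) * D * norm x"
      by (simp add: D(2) power_add algebra_simps)
    finally show ?case .
  qed simp
  have near: "norm (y (n + m) x - y n x) \<le> r ^ n * D * norm x" for n m x
  proof -
    have "r ^ n * (1 - r ^ m) * D * norm x \<le> r ^ n * 1 * D * norm x"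
      using r D(1) by (intro mult_right_mono mult_left_mono) auto
    then show ?thesis using far[of n m x] by simp
  qed
  have "Cauchy (\<lambda>n. y n x)" for x
  proof (rule metric_CauchyI)
    fix e :: real assume e: "e > 0"
    define M where "M = D * norm x + 1"
    have M: "M > 0" using D(1) by (simp add: M_def add_nonneg_pos)
    obtain N where "r ^ N < e / (2 * M)"
      using real_arch_pow_inv[of "e / (2 * M)" r] r e M by auto
    then have N: "r ^ N * M < e / 2" using M by (simp add: field_simps)
    have "dist (y m x) (y N x) < e / 2" if "m \<ge> N" for m
    proof -
      obtain k where "m = N + k" using \<open>m \<ge> N\<close> le_Suc_ex by blast
      then have "dist (y m x) (y N x) \<le> r ^ N * D * norm x" using near by (simp add: dist_norm)
      also have "\<dots> \<le> r ^ N * M" using r by (simp add: M_def algebra_simps)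
      finally show ?thesis using N by simp
    qed
    then have "\<forall>m\<ge>N. \<forall>n\<ge>N. dist (y m x) (y n x) < e"
      using dist_triangle_half_l by (metis dist_commute)
    then show "\<exists>M. \<forall>m\<ge>M. \<forall>n\<ge>M. dist (y m x) (y n x) < e" by blast
  qed
  then have "\<exists>l. (\<lambda>n. y n x) \<longlonglongrightarrow> l" for x
    using Cauchy_convergent_iff convergent_def by blast
  then obtain l where l: "\<And>x. (\<lambda>n. y n x) \<longlonglongrightarrow> l x" by metis
  have lS: "l \<in> S" by (rule limit[OF yS l])
  have near_l: "norm (l x - y n x) \<le> r ^ n * D * norm x" for n x
  proof (rule LIMSEQ_le_const2)
    have "(\<lambda>m. y (n + m) x) \<longlonglongrightarrow> l x"
      using LIMSEQ_ignore_initial_segment[OF l, of n] by (simp add: add.commute)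
    then show "(\<lambda>m. norm (y (n + m) x - y n x)) \<longlonglongrightarrow> norm (l x - y n x)"
      by (intro tendsto_intros)
  qed (use near in auto)
  have "\<Phi> l x = l x" for x
  proof -
    have "norm (\<Phi> l x - y (Suc n) x) \<le> r ^ Suc n * (D * norm x)" for n
      using lipschitz[OF lS yS[of n], of "r ^ n * D" x] near_l r D(1) by (simp add: y_Suc mult.assoc)
    then have "\<forall>\<^sub>F n in sequentially. norm (\<Phi> l x - y (Suc n) x) \<le> r ^ Suc n * (D * norm x)"
      by (intro always_eventually allI)
    moreover have "(\<lambda>n. r ^ Suc n * (D * norm x)) \<longlonglongrightarrow> 0"
      by (rule tendsto_mult_left_zero) (use r in \<open>intro LIMSEQ_Suc LIMSEQ_realpow_zero\<close>)
    ultimately have "(\<lambda>n. \<Phi> l x - y (Suc n) x) \<longlonglongrightarrow> 0"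
      by (rule Lim_null_comparison)
    moreover have "(\<lambda>n. \<Phi> l x - y (Suc n) x) \<longlonglongrightarrow> \<Phi> l x - l x"
      by (intro tendsto_intros LIMSEQ_Suc l)
    ultimately have "\<Phi> l x - l x = 0" by (rule LIMSEQ_unique[rotated])
    then show ?thesis by simp
  qed
  with lS show ?thesis by blast
qed

lemma linear_limit:
  fixes y :: "nat \<Rightarrow> 'a::real_vector \<Rightarrow> 'b::real_normed_vector"
  assumes y: "\<And>n. linear (y n)" and l: "\<And>x. (\<lambda>n. y n x) \<longlonglongrightarrow> l x"
  shows "linear l"
proof (rule linearI)
  fix u v show "l (u + v) = l u + l v"
    using tendsto_add[OF l[of u] l[of v]] LIMSEQ_unique[OF l[of "u + v"]] by (simp add: linear_add[OF y])
next
  fix r u show "l (r *\<^sub>R u) = r *\<^sub>R l u"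
    using tendsto_scaleR[OF tendsto_const l[of u]] LIMSEQ_unique[OF l[of "r *\<^sub>R u"]]
    by (simp add: linear_scale[OF y])
qed

lemma norm_bound_limit:
  fixes y :: "nat \<Rightarrow> 'a::real_normed_vector \<Rightarrow> 'b::real_normed_vector"
  assumes "\<And>n. norm (y n x) \<le> c" and l: "(\<lambda>n. y n x) \<longlonglongrightarrow> l x"
  shows "norm (l x) \<le> c"
  using LIMSEQ_le_const2[OF tendsto_norm[OF l]] assms(1) by blast

lemma symmetric_limit:
  fixes y :: "nat \<Rightarrow> 'a::real_inner \<Rightarrow> 'a"
  assumes y: "\<And>n x z. y n x \<bullet> z = x \<bullet> y n z" and l: "\<And>x. (\<lambda>n. y n x) \<longlonglongrightarrow> l x"
  shows "l x \<bullet> z = x \<bullet> l z"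
proof (rule LIMSEQ_unique)
  show "(\<lambda>n. y n x \<bullet> z) \<longlonglongrightarrow> l x \<bullet> z" by (intro tendsto_intros l)
  show "(\<lambda>n. y n x \<bullet> z) \<longlonglongrightarrow> x \<bullet> l z" unfolding y by (intro tendsto_intros l)
qed

lemma commute_limit:
  fixes y :: "nat \<Rightarrow> 'a::real_normed_vector \<Rightarrow> 'a"
  assumes y: "\<And>n x. y n (A x) = A (y n x)" and l: "\<And>x. (\<lambda>n. y n x) \<longlonglongrightarrow> l x"
    and A: "bounded_linear A"
  shows "l (A x) = A (l x)"
proof (rule LIMSEQ_unique[OF l])
  show "(\<lambda>n. y n (A x)) \<longlonglongrightarrow> A (l x)"
    unfolding y by (intro bounded_linear.tendsto[OF A] l)
qed

text \<open>
  \<open>Y = 1 - \<bar>U\<bar>\<close> is the fixed point of \<open>y \<mapsto> (1 - U\<^sup>2 + y\<^sup>2) / 2\<close> in the ball of radius \<open>1 - g\<close>. The map preserves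
  the ball because \<open>\<parallel>1 - U\<^sup>2\<parallel> \<le> 1 - g\<^sup>2\<close> and \<open>(1 - g\<^sup>2) + (1 - g)\<^sup>2 = 2 (1 - g)\<close>. Symmetry, commutation
  with \<open>U\<close> and invariance of closed \<open>U\<close>-invariant subspaces pass to the fixed point from the iterates.
\<close>

lemma one_minus_abs_exists:
  fixes U :: "'a::{real_inner, complete_space} \<Rightarrow> 'a"
  assumes U: "bounded_linear U" and symU: "\<And>x y. U x \<bullet> y = x \<bullet> U y"
    and g: "0 < g" "g \<le> 1"
    and lower: "\<And>x. g * norm x \<le> norm (U x)" and upper: "\<And>x. norm (U x) \<le> norm x"
  obtains Y where "bounded_linear Y" "\<And>x. norm (Y x) \<le> (1 - g) * norm x"
    "\<And>x. 2 *\<^sub>R Y x = x - U (U x) + Y (Y x)" "\<And>x y. Y x \<bullet> y = x \<bullet> Y y"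
    "\<And>x. Y (U x) = U (Y x)"
    "\<And>W. \<lbrakk>subspace W; closed W; U ` W \<subseteq> W\<rbrakk> \<Longrightarrow> Y ` W \<subseteq> W"
proof -
  let ?r = "1 - g"
  have linU: "linear U" using U by (rule bounded_linear.linear)
  define E where "E x = x - U (U x)" for x
  have blE: "bounded_linear E"
    unfolding E_def by (intro bounded_linear_sub bounded_linear_ident bounded_linear_compose[OF U U])
  have linE: "linear E" using blE by (rule bounded_linear.linear)
  have symE: "E x \<bullet> y = x \<bullet> E y" for x y
    by (simp add: E_def inner_diff_left inner_diff_right symU)
  have Exx: "E x \<bullet> x = (norm x)\<^sup>2 - (norm (U x))\<^sup>2" for x
    by (simp add: E_def inner_diff_left symU power2_norm_eq_inner)
  have normE: "norm (E x) \<le> (1 - g\<^sup>2) * norm x" for x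
  proof (rule symmetric_norm_bound[OF linE symE])
    show "0 \<le> 1 - g\<^sup>2" using g by (simp add: power_le_one)
    show "0 \<le> E z \<bullet> z" for z
      unfolding Exx using power_mono[OF upper[of z] norm_ge_zero, of 2] by simp
    show "E z \<bullet> z \<le> (1 - g\<^sup>2) * (norm z)\<^sup>2" for z
      unfolding Exx using power_mono[OF lower[of z], of 2] g by (simp add: power_mult_distrib algebra_simps)
  qed
  define f where "f y x = (1/2) *\<^sub>R (E x + y (y x))" for y and x :: 'a
  define S where "S = {y. linear y \<and> (\<forall>x. norm (y x) \<le> ?r * norm x) \<and> (\<forall>x z. y x \<bullet> z = x \<bullet> y z) \<and>
     (\<forall>x. y (U x) = U (y x)) \<and>
     (\<forall>W. subspace W \<longrightarrow> closed W \<longrightarrow> U ` W \<subseteq> W \<longrightarrow> (\<forall>x\<in>W. y x \<in> W))}"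
  have bound2: "norm (E x + y (y x)) \<le> 2 * (?r * norm x)" if y: "\<And>x. norm (y x) \<le> ?r * norm x" for y x
  proof -
    have "norm (y (y x)) \<le> ?r * (?r * norm x)"
      using y[of "y x"] mult_left_mono[OF y[of x], of ?r] g by simp
    then have "norm (E x + y (y x)) \<le> (1 - g\<^sup>2) * norm x + ?r * (?r * norm x)"
      using norm_triangle_ineq[of "E x" "y (y x)"] normE[of x] by linarith
    also have "\<dots> = 2 * (?r * norm x)" by (simp add: power2_eq_square algebra_simps)
    finally show ?thesis .
  qed
  have "\<exists>y\<in>S. f y = y"
  proof (rule operator_fixed_point[where r = ?r and c = ?r and ?y0.0 = "\<lambda>x. 0"])
    show "(\<lambda>x. 0) \<in> S"
      unfolding S_def using g linear_0[OF linU] linear_zero by (auto simp: subspace_0)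
    show "0 \<le> ?r" "?r < 1" "0 \<le> ?r" using g by auto
    show "norm (f (\<lambda>x. 0) x - 0) \<le> ?r * norm x" for x
      using bound2[of "\<lambda>x. 0" x] g by (simp add: f_def)
    show "f y \<in> S" if y: "y \<in> S" for y
    proof -
      have ly: "linear y" and ny: "\<And>x. norm (y x) \<le> ?r * norm x" and sy: "\<And>x z. y x \<bullet> z = x \<bullet> y z"
        and cy: "\<And>x. y (U x) = U (y x)"
        using y unfolding S_def by auto
      have "linear (f y)"
        by (rule linearI)
          (simp_all add: f_def linear_add[OF linE] linear_add[OF ly] linear_scale[OF linE]
            linear_scale[OF ly] algebra_simps)
      moreover have "norm (f y x) \<le> ?r * norm x" for x
        using bound2[OF ny, of x] by (simp add: f_def)
      moreover have "f y x \<bullet> z = x \<bullet> f y z" for x z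
        by (simp add: f_def inner_add_left inner_add_right symE sy)
      moreover have "f y (U x) = U (f y x)" for x
        by (simp add: f_def linear_add[OF linU] linear_scale[OF linU] linear_diff[OF linU] cy E_def)
      moreover have "f y x \<in> W" if W: "subspace W" "closed W" "U ` W \<subseteq> W" "x \<in> W" for W x
      proof -
        have "y (y x) \<in> W" using y W unfolding S_def by blast
        moreover have "E x \<in> W" unfolding E_def using W by (intro subspace_diff) auto
        ultimately show ?thesis unfolding f_def using W by (intro subspace_scale subspace_add)
      qed
      ultimately show ?thesis unfolding S_def by blast
    qed
    show "norm (f y x - f z x) \<le> ?r * d * norm x"
      if "y \<in> S" "z \<in> S" and d: "0 \<le> d" "\<And>x. norm (y x - z x) \<le> d * norm x" for y z d x
    proof -
      have ly: "linear y" and n: "\<And>x. norm (y x) \<le> ?r * norm x" "\<And>x. norm (z x) \<le> ?r * norm x"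
        using that unfolding S_def by auto
      have "2 * norm (f y x - f z x) = norm (2 *\<^sub>R (f y x - f z x))" by simp
      also have "2 *\<^sub>R (f y x - f z x) = y (y x - z x) + (y (z x) - z (z x))"
        by (simp add: f_def linear_diff[OF ly] scaleR_diff_right)
      also have "norm \<dots> \<le> norm (y (y x - z x)) + norm (y (z x) - z (z x))" by (rule norm_triangle_ineq)
      also have "\<dots> \<le> ?r * (d * norm x) + d * (?r * norm x)"
      proof (rule add_mono)
        show "norm (y (y x - z x)) \<le> ?r * (d * norm x)"
          using n(1)[of "y x - z x"] mult_left_mono[OF d(2)[of x], of ?r] g by simp
        show "norm (y (z x) - z (z x)) \<le> d * (?r * norm x)"
          using d(2)[of "z x"] mult_left_mono[OF n(2)[of x] d(1)] by simp
      qed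
      finally show ?thesis by (simp add: algebra_simps)
    qed
    show "l \<in> S" if y: "\<And>n::nat. y n \<in> S" and l: "\<And>x. (\<lambda>n. y n x) \<longlonglongrightarrow> l x" for y l
    proof -
      have "linear l" by (rule linear_limit[OF _ l]) (use y in \<open>auto simp: S_def\<close>)
      moreover have "norm (l x) \<le> ?r * norm x" for x
        by (rule norm_bound_limit[where y = y, OF _ l]) (use y in \<open>auto simp: S_def\<close>)
      moreover have "l x \<bullet> z = x \<bullet> l z" for x z
        by (rule symmetric_limit[OF _ l]) (use y in \<open>auto simp: S_def\<close>)
      moreover have "l (U x) = U (l x)" for x
        by (rule commute_limit[OF _ l U]) (use y in \<open>auto simp: S_def\<close>)
      moreover have "l x \<in> W" if "subspace W" "closed W" "U ` W \<subseteq> W" "x \<in> W" for W x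
        using closed_sequentially[OF that(2) _ l[of x]] y that unfolding S_def by blast
      ultimately show ?thesis unfolding S_def by blast
    qed
  qed
  then obtain Y where Y: "Y \<in> S" "f Y = Y" by blast
  have nY: "norm (Y x) \<le> ?r * norm x" for x using Y(1) by (simp add: S_def)
  have "2 *\<^sub>R Y x = x - U (U x) + Y (Y x)" for x
  proof -
    have "Y x = (1/2) *\<^sub>R (E x + Y (Y x))" using Y(2) f_def by metis
    then have "2 *\<^sub>R Y x = 2 *\<^sub>R ((1/2) *\<^sub>R (E x + Y (Y x)))" by simp
    then show ?thesis by (simp add: E_def)
  qed
  moreover have "Y ` W \<subseteq> W" if "subspace W" "closed W" "U ` W \<subseteq> W" for W
    using Y(1) that unfolding S_def by blast
  moreover have "bounded_linear Y"
    using Y(1) nY unfolding S_def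
    by (intro bounded_linear_intro[where K = ?r]) (auto simp: linear_add linear_scale mult.commute)
  moreover have "Y x \<bullet> z = x \<bullet> Y z" "Y (U x) = U (Y x)" for x z
    using Y(1) unfolding S_def by blast+
  ultimately show thesis using that[of Y] nY by blast
qed

text \<open>
  The sign is the fixed point of \<open>j \<mapsto> U + Y j\<close>, a contraction with constant \<open>1 - g\<close> that preserves
  the bound \<open>1 / g\<close> and commutation with \<open>U\<close> and \<open>Y\<close>.
\<close>

lemma operator_sign_exists:
  fixes U :: "'a::{real_inner, complete_space} \<Rightarrow> 'a"
  assumes U: "bounded_linear U" and symU: "\<And>x y. U x \<bullet> y = x \<bullet> U y"
    and g: "0 < g" "g \<le> 1"
    and lower: "\<And>x. g * norm x \<le> norm (U x)" and upper: "\<And>x. norm (U x) \<le> norm x"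
  shows "\<exists>Y J. operator_sign g U Y J"
proof -
  let ?r = "1 - g"
  obtain Y where Y: "bounded_linear Y" "\<And>x. norm (Y x) \<le> ?r * norm x"
    "\<And>x. 2 *\<^sub>R Y x = x - U (U x) + Y (Y x)" and symY: "\<And>x y. Y x \<bullet> y = x \<bullet> Y y"
    and YU: "\<And>x. Y (U x) = U (Y x)"
    and inv: "\<And>W. \<lbrakk>subspace W; closed W; U ` W \<subseteq> W\<rbrakk> \<Longrightarrow> Y ` W \<subseteq> W"
    using one_minus_abs_exists[OF assms] by metis
  have linU: "linear U" and linY: "linear Y" using U Y(1) by (auto intro: bounded_linear.linear)
  define f where "f j x = U x + Y (j x)" for j and x :: 'a
  define S where "S = {j. linear j \<and> (\<forall>x. norm (j x) \<le> (1 / g) * norm x) \<and>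
    (\<forall>x z. j x \<bullet> z = x \<bullet> j z) \<and> (\<forall>x. j (U x) = U (j x)) \<and> (\<forall>x. j (Y x) = Y (j x))}"
  have "\<exists>j\<in>S. f j = j"
  proof (rule operator_fixed_point[where r = ?r and c = 1 and ?y0.0 = "\<lambda>x. 0"])
    show "(\<lambda>x. 0) \<in> S"
      unfolding S_def using g linear_0[OF linU] linear_0[OF linY] linear_zero by auto
    show "0 \<le> ?r" "?r < 1" "0 \<le> (1::real)" using g by auto
    show "norm (f (\<lambda>x. 0) x - 0) \<le> 1 * norm x" for x
      using upper by (simp add: f_def linear_0[OF linY])
    show "f j \<in> S" if "j \<in> S" for j
    proof -
      have lj: "linear j" and nj: "\<And>x. norm (j x) \<le> (1 / g) * norm x"
        and j: "\<And>x z. j x \<bullet> z = x \<bullet> j z" "\<And>x. j (U x) = U (j x)" "\<And>x. j (Y x) = Y (j x)"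
        using \<open>j \<in> S\<close> unfolding S_def by auto
      have "linear (f j)"
        by (rule linearI)
          (simp_all add: f_def linear_add[OF linU] linear_add[OF linY] linear_add[OF lj]
            linear_scale[OF linU] linear_scale[OF linY] linear_scale[OF lj] algebra_simps)
      moreover have "norm (f j x) \<le> (1 / g) * norm x" for x
      proof -
        have "norm (f j x) \<le> norm x + ?r * ((1 / g) * norm x)"
          unfolding f_def
          using norm_triangle_ineq[of "U x" "Y (j x)"] upper[of x] Y(2)[of "j x"]
            mult_left_mono[OF nj[of x], of ?r] g by linarith
        also have "\<dots> = (1 / g) * norm x" using g by (simp add: field_simps)
        finally show ?thesis .
      qed
      moreover have "f j x \<bullet> z = x \<bullet> f j z" for x z
      proof -
        have "Y (j x) \<bullet> z = x \<bullet> Y (j z)" using symY[of "j x" z] j(1)[of x "Y z"] j(3) by simp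
        then show ?thesis unfolding f_def by (simp add: inner_add_left inner_add_right symU)
      qed
      moreover have "f j (U x) = U (f j x)" "f j (Y x) = Y (f j x)" for x
        by (simp_all add: f_def linear_add[OF linU] linear_add[OF linY] j YU)
      ultimately show "f j \<in> S" unfolding S_def by blast
    qed
    show "norm (f y x - f z x) \<le> ?r * d * norm x"
      if "y \<in> S" "z \<in> S" and d: "0 \<le> d" "\<And>x. norm (y x - z x) \<le> d * norm x" for y z d x
    proof -
      have "f y x - f z x = Y (y x - z x)" by (simp add: f_def linear_diff[OF linY])
      then show ?thesis
        using Y(2)[of "y x - z x"] mult_left_mono[OF d(2)[of x], of ?r] g by (simp add: mult.assoc)
    qed
    show "l \<in> S" if y: "\<And>n::nat. y n \<in> S" and l: "\<And>x. (\<lambda>n. y n x) \<longlonglongrightarrow> l x" for y l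
    proof -
      have "linear l" by (rule linear_limit[OF _ l]) (use y in \<open>auto simp: S_def\<close>)
      moreover have "norm (l x) \<le> (1 / g) * norm x" for x
        by (rule norm_bound_limit[where y = y, OF _ l]) (use y in \<open>auto simp: S_def\<close>)
      moreover have "l x \<bullet> z = x \<bullet> l z" for x z
        by (rule symmetric_limit[OF _ l]) (use y in \<open>auto simp: S_def\<close>)
      moreover have "l (U x) = U (l x)" for x
        by (rule commute_limit[OF _ l U]) (use y in \<open>auto simp: S_def\<close>)
      moreover have "l (Y x) = Y (l x)" for x
        by (rule commute_limit[OF _ l Y(1)]) (use y in \<open>auto simp: S_def\<close>)
      ultimately show ?thesis unfolding S_def by blast
    qed
  qed
  then obtain j where j: "j \<in> S" "f j = j" by blast
  have lj: "linear j" and nj: "\<And>x. norm (j x) \<le> (1 / g) * norm x"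
    and jS: "\<And>x z. j x \<bullet> z = x \<bullet> j z" "\<And>x. j (U x) = U (j x)" "\<And>x. j (Y x) = Y (j x)"
    using j(1) unfolding S_def by auto
  have blj: "bounded_linear j"
    by (rule bounded_linear_intro[where K = "1 / g"])
      (use nj in \<open>auto simp: linear_add[OF lj] linear_scale[OF lj] mult.commute\<close>)
  have eqJ: "j x = U x + Y (j x)" for x using j(2) f_def by metis
  have R_inj: "x = 0" if "x = Y x" for x
  proof -
    have "norm x \<le> ?r * norm x" using Y(2)[of x] that by simp
    then show ?thesis using g by (simp add: algebra_simps mult_le_0_iff)
  qed
  have JJ: "j (j x) = x" for x
  proof -
    define w where "w = j (j x) - x"
    have Rj: "j y - Y (j y) = U y" for y using eqJ[of y] by (simp add: algebra_simps)
    \<comment> \<open>with \<open>R = 1 - Y\<close>: \<open>R\<^sup>2 (j\<^sup>2 x) = U\<^sup>2 x = R\<^sup>2 x\<close>, and \<open>R\<close> is injective\<close>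
    define a b where "a = j (j x) - Y (j (j x))" and "b = x - Y x"
    have "a - Y a = U (U x)"
    proof -
      have "U (j x) - Y (U (j x)) = U (U x)"
        using Rj[of x] by (simp add: YU linear_diff[OF linU, symmetric])
      then show ?thesis using Rj[of "j x"] by (simp add: a_def)
    qed
    moreover have "b - Y b = U (U x)"
      using Y(3)[of x] by (simp add: b_def linear_diff[OF linY] scaleR_2 algebra_simps)
    moreover have "(a - b) - Y (a - b) = (a - Y a) - (b - Y b)"
      by (simp add: linear_diff[OF linY])
    ultimately have "a - b = Y (a - b)" by simp
    moreover have "w - Y w = a - b"
      by (simp add: w_def a_def b_def linear_diff[OF linY])
    ultimately have "w - Y w = Y (w - Y w)" by (simp only:)
    then have "w = Y w" using R_inj[of "w - Y w"] by simp
    then show ?thesis using R_inj[of w] by (simp add: w_def)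
  qed
  have "operator_sign g U Y j"
    by (rule operator_sign.intro) (fact g U Y YU eqJ jS JJ blj | rule inv, assumption+)+
  then show ?thesis by blast
qed

context operator_sign
begin

lemma linU: "linear U" and linY: "linear Y" and linJ: "linear J"
  using blU blY blJ by (auto intro: bounded_linear.linear)

lemma sign_eqI: "w - Y w = U x \<Longrightarrow> J x = w"
proof -
  assume "w - Y w = U x"
  moreover have "a - w = b - c" if "a = u + b" "w - c = u" for a b c u :: 'a
    using that by (simp add: algebra_simps)
  ultimately have "J x - w = Y (J x - w)"
    unfolding linear_diff[OF linY] using eqJ[of x] by blast
  then have "norm (J x - w) \<le> (1 - g) * norm (J x - w)" using normY[of "J x - w"] by simp
  then show ?thesis using g_pos by (simp add: algebra_simps mult_le_0_iff)
qed

lemma abs_inner_ge: "g * (norm x)\<^sup>2 \<le> (x - Y x) \<bullet> x"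
proof -
  have "Y x \<bullet> x \<le> norm (Y x) * norm x" by (rule norm_cauchy_schwarz)
  also have "\<dots> \<le> (1 - g) * norm x * norm x" by (intro mult_right_mono normY) simp
  finally show ?thesis by (simp add: inner_diff_left power2_norm_eq_inner[symmetric] power2_eq_square algebra_simps)
qed

lemma inner_le_if_sign_neg: "J x = - x \<Longrightarrow> U x \<bullet> x \<le> - g * (norm x)\<^sup>2"
proof -
  assume "J x = - x"
  then have "U x = - (x - Y x)" using eqJ[of x] by (simp add: linear_neg[OF linY] algebra_simps)
  then have "U x \<bullet> x = - ((x - Y x) \<bullet> x)" by (simp only: inner_minus_left)
  then show ?thesis using abs_inner_ge[of x] by linarith
qed

lemma inner_ge_if_sign_pos: "J x = x \<Longrightarrow> g * (norm x)\<^sup>2 \<le> U x \<bullet> x"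
proof -
  assume "J x = x"
  then have "U x = x - Y x" using eqJ[of x] by (simp add: algebra_simps)
  then show ?thesis using abs_inner_ge[of x] by simp
qed

lemma abs_squared: "U (U x) = (x - Y x) - Y (x - Y x)"
  using eqY[of x] by (simp add: linear_diff[OF linY] scaleR_2 algebra_simps)

lemma sign_abs_plus: "J (x - Y x + U x) = x - Y x + U x"
  by (rule sign_eqI)
    (simp add: abs_squared linear_add[OF linU] linear_diff[OF linU] linear_add[OF linY] YU)

lemma sign_abs_minus: "J (x - Y x - U x) = - (x - Y x - U x)"
  by (rule sign_eqI)
    (simp add: abs_squared linear_neg[OF linY] linear_diff[OF linU] linear_diff[OF linY] YU)

lemma closed_subspace_neg: "closed_subspace {x. J x = - x}"
proof
  show "subspace {x. J x = - x}"
    by (auto simp: subspace_def linear_0[OF linJ] linear_add[OF linJ] linear_scale[OF linJ])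
  show "closed {x. J x = - x}"
    by (intro closed_Collect_eq linear_continuous_on blJ continuous_intros)
qed

lemma proj_neg: "orth_proj {x. J x = - x} x = (1/2) *\<^sub>R (x - J x)"
proof (rule orth_proj_eqI)
  show "subspace {x. J x = - x}" using closed_subspace_neg by (rule closed_subspace.sub)
  show "(1/2) *\<^sub>R (x - J x) \<in> {x. J x = - x}"
    by (simp add: linear_scale[OF linJ] linear_diff[OF linJ] JJ algebra_simps)
  have "(x - (1/2) *\<^sub>R (x - J x)) \<bullet> n = 0" if "J n = - n" for n
    using symJ[of x n] that by (simp add: inner_diff_left)
  then show "x - (1/2) *\<^sub>R (x - J x) \<in> {x. J x = - x}\<^sup>\<bottom>" by (auto simp: orth_comp_iff)
qed

end

text \<open>
  Both \<open>Y - Y'\<close> and \<open>J - J'\<close> solve contractive equations whose inhomogeneous part is compact.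
\<close>

lemma operator_sign_difference_compact:
  fixes U U' :: "'a::{real_inner, complete_space} \<Rightarrow> 'a"
  assumes "operator_sign g U Y J" "operator_sign g' U' Y' J'"
    and cU: "compact_operator (\<lambda>x. U x - U' x)"
  shows "compact_operator (\<lambda>x. J x - J' x)"
proof -
  interpret s: operator_sign g U Y J by fact
  interpret s': operator_sign g' U' Y' J' by fact
  define r where "r = max (1 - g) (1 - g')"
  have r: "0 \<le> r" "r < 1" using s.g_pos s.g_le s'.g_pos by (auto simp: r_def)
  have nY: "norm (Y x) \<le> r * norm x" "norm (Y' x) \<le> r * norm x" for x
    using s.normY[of x] s'.normY[of x] mult_right_mono[of "1 - g" r "norm x"]
      mult_right_mono[of "1 - g'" r "norm x"] by (auto simp: r_def)
  define F where "F x = (U' (U' x) - U (U x))" for x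
  have "compact_operator (\<lambda>x. - 1 *\<^sub>R (U (U x - U' x) + (U (U' x) - U' (U' x))))"
    by (intro compact_operator_scaleR compact_operator_add
        compact_operator_compose_left[OF cU s.blU] compact_operator_compose_right[OF cU s'.blU])
  then have cF: "compact_operator F"
    by (simp add: F_def[abs_def] linear_diff[OF s.linU])
  have cX: "compact_operator (\<lambda>x. Y x - Y' x)"
  proof (rule compact_operator_if_contractive[OF _ r])
    show "bounded_linear (\<lambda>x. Y x - Y' x)" by (intro bounded_linear_sub s.blY s'.blY)
    fix L :: "'a \<Rightarrow> 'a" and d
    assume L: "compact_operator L" and d: "0 \<le> d" "\<And>x. norm (Y x - Y' x - L x) \<le> d * norm x"
    define L' where "L' x = (1/2) *\<^sub>R (F x + (Y (L x) + L (Y' x)))" for x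
    have "compact_operator L'"
      unfolding L'_def
      by (intro compact_operator_scaleR compact_operator_add cF
          compact_operator_compose_left[OF L s.blY] compact_operator_compose_right[OF L s'.blY])
    moreover have "norm (Y x - Y' x - L' x) \<le> r * d * norm x" for x
    proof -
      have "2 *\<^sub>R (Y x - Y' x - L' x) = 2 *\<^sub>R Y x - 2 *\<^sub>R Y' x - (F x + (Y (L x) + L (Y' x)))"
        by (simp add: L'_def scaleR_diff_right)
      also have "\<dots> = Y (Y x - Y' x - L x) + (Y (Y' x) - Y' (Y' x) - L (Y' x))"
        by (simp add: s.eqY s'.eqY F_def linear_diff[OF s.linY])
      finally have "2 * norm (Y x - Y' x - L' x)
          \<le> norm (Y (Y x - Y' x - L x)) + norm (Y (Y' x) - Y' (Y' x) - L (Y' x))"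
        by (metis abs_numeral norm_scaleR norm_triangle_ineq)
      also have "\<dots> \<le> r * (d * norm x) + d * (r * norm x)"
        using nY(1)[of "Y x - Y' x - L x"] mult_left_mono[OF d(2)[of x] r(1)]
          d(2)[of "Y' x"] mult_left_mono[OF nY(2)[of x] d(1)] by linarith
      finally show ?thesis by (simp add: algebra_simps)
    qed
    ultimately show "\<exists>L'. compact_operator L' \<and> (\<forall>x. norm (Y x - Y' x - L' x) \<le> r * d * norm x)"
      by blast
  qed
  show ?thesis
  proof (rule compact_operator_if_contractive[OF _ r])
    show "bounded_linear (\<lambda>x. J x - J' x)" by (intro bounded_linear_sub s.blJ s'.blJ)
    fix L :: "'a \<Rightarrow> 'a" and d
    assume L: "compact_operator L" and d: "0 \<le> d" "\<And>x. norm (J x - J' x - L x) \<le> d * norm x"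
    define L' where "L' x = (U x - U' x) + ((Y (J' x) - Y' (J' x)) + Y (L x))" for x
    have "compact_operator L'"
      unfolding L'_def
      by (intro compact_operator_add cU compact_operator_compose_left[OF L s.blY]
          compact_operator_compose_right[OF cX s'.blJ])
    moreover have "norm (J x - J' x - L' x) \<le> r * d * norm x" for x
    proof -
      have "U x = J x - Y (J x)" "U' x = J' x - Y' (J' x)"
        using s.eqJ[of x] s'.eqJ[of x] by (metis add_diff_cancel_right')+
      then have "J x - J' x - L' x = Y (J x - J' x - L x)"
        by (simp add: L'_def linear_diff[OF s.linY])
      then show ?thesis
        using nY(1)[of "J x - J' x - L x"] mult_left_mono[OF d(2)[of x] r(1)] by (simp add: mult.assoc)
    qed
    ultimately show "\<exists>L'. compact_operator L' \<and> (\<forall>x. norm (J x - J' x - L' x) \<le> r * d * norm x)"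
      by blast
  qed
qed

section \<open>The spectral splitting\<close>

context symmetric_closed_range
begin

text \<open>
  Adding the projection onto the kernel makes \<open>T\<close> invertible without changing it on the complement
  of the kernel; the scale \<open>C\<close> is left open so that two operators can be given the same one.
\<close>

lemma operator_sign_exists_scaled:
  "\<exists>C0\<ge>1. \<forall>C\<ge>C0. \<exists>g Y J. operator_sign g (\<lambda>x. inverse C *\<^sub>R (T x + orth_proj Ker x)) Y J"
proof -
  interpret K: closed_subspace Ker by (rule closed_subspace_ker)
  obtain c where c: "c > 0" "\<And>x. x \<in> Ker\<^sup>\<bottom> \<Longrightarrow> c * norm x \<le> norm (T x)"
    using bounded_below by blast
  obtain b where b: "b > 0" "\<And>x. norm (T x) \<le> norm x * b"
    using bounded_linear.pos_bounded[OF bl] by blast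
  define m where "m = min c 1"
  have m: "0 < m" "m \<le> 1" "m \<le> c" using c(1) by (auto simp: m_def)
  define A where "A x = T x + orth_proj Ker x" for x
  have blA: "bounded_linear A"
    unfolding A_def by (intro bounded_linear_add bl K.proj_bounded_linear)
  have symA: "A x \<bullet> y = x \<bullet> A y" for x y
    by (simp add: A_def inner_add_left inner_add_right sym K.proj_sym)
  have upper: "norm (A x) \<le> (b + 1) * norm x" for x
  proof -
    have "norm (A x) \<le> norm (T x) + norm (orth_proj Ker x)"
      unfolding A_def by (rule norm_triangle_ineq)
    then show ?thesis using b(2)[of x] K.proj_norm[of x] by (simp add: algebra_simps)
  qed
  have lower: "m * norm x \<le> norm (A x)" for x
  proof -
    define k y where "k = orth_proj Ker x" and "y = x - k"
    have k: "k \<in> Ker" and y: "y \<in> Ker\<^sup>\<bottom>"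
      unfolding k_def y_def by (rule K.proj_in, rule K.proj_perp)
    have pyth: "(norm (u + v))\<^sup>2 = (norm u)\<^sup>2 + (norm v)\<^sup>2" if "u \<in> Ker\<^sup>\<bottom>" "v \<in> Ker" for u v
    proof -
      have "u \<bullet> v = 0" using that unfolding orth_comp_iff by blast
      then show ?thesis by (rule norm_add_Pythagorean[unfolded orthogonal_def])
    qed
    have xyk: "x = y + k" by (simp add: y_def)
    have Tx: "T x = T y" using k by (simp add: xyk linear_add[OF lin])
    have "T y \<in> Ker\<^sup>\<bottom>" using range_eq by blast
    then have "(norm (A x))\<^sup>2 = (norm (T y))\<^sup>2 + (norm k)\<^sup>2"
      using pyth k unfolding A_def k_def[symmetric] Tx by blast
    moreover have "(m * norm y)\<^sup>2 \<le> (norm (T y))\<^sup>2"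
    proof (rule power_mono)
      show "m * norm y \<le> norm (T y)"
        using c(2)[OF y] mult_right_mono[OF m(3) norm_ge_zero[of y]] by linarith
    qed (use m in simp)
    moreover have "(m * norm k)\<^sup>2 \<le> (norm k)\<^sup>2"
      using m by (intro power_mono mult_left_le_one_le) auto
    moreover have "(m * norm x)\<^sup>2 = (m * norm y)\<^sup>2 + (m * norm k)\<^sup>2"
      using pyth[OF y k] by (simp add: xyk[symmetric] power_mult_distrib distrib_left)
    ultimately have "(m * norm x)\<^sup>2 \<le> (norm (A x))\<^sup>2" by linarith
    then show ?thesis by (rule power2_le_imp_le) simp
  qed
  have "\<exists>g Y J. operator_sign g (\<lambda>x. inverse C *\<^sub>R A x) Y J" if C: "C \<ge> b + 1" for C
  proof -
    have C1: "C \<ge> 1" "C > 0" using C b(1) by auto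
    have "\<exists>Y J. operator_sign (m / C) (\<lambda>x. inverse C *\<^sub>R A x) Y J"
    proof (rule operator_sign_exists)
      show "bounded_linear (\<lambda>x. inverse C *\<^sub>R A x)"
        by (rule bounded_linear_compose[OF bounded_linear_scaleR_right blA])
      show "inverse C *\<^sub>R A x \<bullet> y = x \<bullet> inverse C *\<^sub>R A y" for x y by (simp add: symA)
      show "0 < m / C" "m / C \<le> 1" using m C1 by (auto simp: pos_divide_le_eq)
      show "m / C * norm x \<le> norm (inverse C *\<^sub>R A x)" for x
        using lower[of x] C1 by (simp add: divide_simps)
      show "norm (inverse C *\<^sub>R A x) \<le> norm x" for x
      proof -
        have "norm (A x) \<le> C * norm x"
          using upper[of x] mult_right_mono[OF C norm_ge_zero[of x]] by linarith
        then show ?thesis using C1 by (simp add: divide_simps mult.commute)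
      qed
    qed
    then show ?thesis by blast
  qed
  then show ?thesis using b(1) unfolding A_def by (intro exI[of _ "b + 1"]) auto
qed

context
  fixes C g :: real and Y J :: "'a \<Rightarrow> 'a"
  assumes C: "C > 0" and sg: "operator_sign g (\<lambda>x. inverse C *\<^sub>R (T x + orth_proj Ker x)) Y J"
begin

interpretation K: closed_subspace Ker by (rule closed_subspace_ker)
interpretation s: operator_sign g "\<lambda>x. inverse C *\<^sub>R (T x + orth_proj Ker x)" Y J by (rule sg)

abbreviation "U \<equiv> (\<lambda>x. inverse C *\<^sub>R (T x + orth_proj Ker x))"

lemma scaled_perp: "x \<in> Ker\<^sup>\<bottom> \<Longrightarrow> T x = C *\<^sub>R U x"
  using C by (simp add: K.proj_zero)

lemma sign_ker: "T k = 0 \<Longrightarrow> J k = k"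
proof (rule s.sign_eqI)
  assume k: "T k = 0"
  have Uk: "U k = inverse C *\<^sub>R k" using k by simp
  define w where "w = (k - Y k) - inverse C *\<^sub>R k"
  \<comment> \<open>\<open>\<bar>U\<bar>\<^sup>2 k = C\<^sup>-\<^sup>2 k\<close>, so \<open>w\<close> lies in the kernel of \<open>\<bar>U\<bar> + C\<^sup>-\<^sup>1\<close>\<close>
  have "U (U k) = inverse C *\<^sub>R U k"
    unfolding Uk using linear_scale[OF s.linU, of "inverse C" k] Uk by simp
  then have "(k - Y k) - Y (k - Y k) = inverse C *\<^sub>R inverse C *\<^sub>R k"
    using s.abs_squared[of k] Uk by metis
  then have "w - Y w = - inverse C *\<^sub>R w"
    by (simp add: w_def linear_diff[OF s.linY] linear_add[OF s.linY] linear_scale[OF s.linY] algebra_simps)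
  then have "(w - Y w) \<bullet> w = - inverse C * (w \<bullet> w)" by simp
  moreover have "0 \<le> inverse C * (w \<bullet> w)" using C by simp
  ultimately have "g * (norm w)\<^sup>2 \<le> 0" using s.abs_inner_ge[of w] by linarith
  then have "w = 0" using s.g_pos by (simp add: mult_le_0_iff)
  then show "k - Y k = U k" unfolding Uk by (simp add: w_def)
qed

lemma neg_perp_pos: "J x = - x \<Longrightarrow> J y = y \<Longrightarrow> x \<bullet> y = 0"
  using s.symJ[of x y] by simp

lemma neg_perp_ker: "J x = - x \<Longrightarrow> x \<in> Ker\<^sup>\<bottom>"
  unfolding orth_comp_iff using neg_perp_pos sign_ker by blast

lemma inner_le_on_neg: "J x = - x \<Longrightarrow> T x \<bullet> x \<le> - (C * g) * (norm x)\<^sup>2"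
proof -
  assume x: "J x = - x"
  have "T x \<bullet> x = C * (U x \<bullet> x)" using scaled_perp[OF neg_perp_ker[OF x]] by (metis inner_scaleR_left)
  also have "\<dots> \<le> C * (- g * (norm x)\<^sup>2)"
    using s.inner_le_if_sign_neg[OF x] C by (intro mult_left_mono) auto
  finally show ?thesis by simp
qed

lemma inner_ge_on_pos: "J x = x \<Longrightarrow> x \<in> Ker\<^sup>\<bottom> \<Longrightarrow> C * g * (norm x)\<^sup>2 \<le> T x \<bullet> x"
proof -
  assume x: "J x = x" "x \<in> Ker\<^sup>\<bottom>"
  have "C * (g * (norm x)\<^sup>2) \<le> C * (U x \<bullet> x)"
    using s.inner_ge_if_sign_pos[OF x(1)] C by (intro mult_left_mono) auto
  also have "\<dots> = T x \<bullet> x" using scaled_perp[OF x(2)] by (metis inner_scaleR_left)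
  finally show ?thesis by simp
qed

text \<open>
  The symmetric involution \<open>J\<close> splits the space into two orthogonal eigenspaces. The kernel of \<open>T\<close> lies in the
  eigenspace for \<open>1\<close> and is split off there.
\<close>

lemma spectral_splitting_sign:
  "spectral_splitting UNIV T {x. J x = - x} {x \<in> Ker\<^sup>\<bottom>. J x = x}"
proof -
  have Cg: "0 < C * g" using C s.g_pos by simp
  have orth: "orthogonal x y" if "J x = - x" "J y = y" for x y
    using neg_perp_pos[OF that] by (simp add: orthogonal_def)
  have P: "subspace {x \<in> Ker\<^sup>\<bottom>. J x = x}"
    using subspace_orthogonal_comp[of Ker]
    by (auto simp: subspace_def linear_0[OF s.linJ] linear_add[OF s.linJ] linear_scale[OF s.linJ])
  have clP: "closed {x \<in> Ker\<^sup>\<bottom>. J x = x}"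
  proof -
    have "{x \<in> Ker\<^sup>\<bottom>. J x = x} = Ker\<^sup>\<bottom> \<inter> {x. J x = x}" by auto
    then show ?thesis
      by (auto intro!: closed_Int closed_orth_comp closed_Collect_eq linear_continuous_on s.blJ continuous_intros)
  qed
  have dec: "\<exists>x\<in>{x. J x = - x}. \<exists>y\<in>{x \<in> Ker\<^sup>\<bottom>. J x = x}. \<exists>z\<in>Ker. w = x + y + z" for w
  proof -
    define x y' where "x = (1/2) *\<^sub>R (w - J w)" and "y' = (1/2) *\<^sub>R (w + J w)"
    define z where "z = orth_proj Ker y'"
    have x: "J x = - x" and y': "J y' = y'"
      by (simp_all add: x_def y'_def linear_scale[OF s.linJ] linear_diff[OF s.linJ]
          linear_add[OF s.linJ] s.JJ algebra_simps)
    have z: "z \<in> Ker" unfolding z_def by (rule K.proj_in)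
    have "J (y' - z) = y' - z" using y' sign_ker z by (simp add: linear_diff[OF s.linJ])
    moreover have "y' - z \<in> Ker\<^sup>\<bottom>" unfolding z_def by (rule K.proj_perp)
    moreover have "w = x + y'"
      unfolding x_def y'_def scaleR_add_right[symmetric] by (simp add: scaleR_2[symmetric])
    then have "w = x + (y' - z) + z" by simp
    ultimately show ?thesis using x z by blast
  qed
  have TN: "J (T x) = - T x" if x: "J x = - x" for x
  proof -
    have "J (U x) = - U x" using s.JU[of x] x linear_neg[OF s.linU, of x] by simp
    then have "J (C *\<^sub>R U x) = - (C *\<^sub>R U x)"
      unfolding linear_scale[OF s.linJ] by (simp only: scaleR_minus_right)
    then show ?thesis unfolding scaled_perp[OF neg_perp_ker[OF x], symmetric] .
  qed
  have TP: "J (T x) = T x" if x: "x \<in> Ker\<^sup>\<bottom>" "J x = x" for x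
  proof -
    have "J (U x) = U x" using s.JU[of x] x by simp
    then have "J (C *\<^sub>R U x) = C *\<^sub>R U x"
      unfolding linear_scale[OF s.linJ] by (simp only:)
    then show ?thesis unfolding scaled_perp[OF x(1), symmetric] .
  qed
  have "negative_definite_on {x. J x = - x} (\<lambda>x y. T x \<bullet> y)"
    unfolding negative_definite_on_def
  proof (intro ballI impI)
    fix x assume x: "x \<in> {x. J x = - x}" "x \<noteq> 0"
    then have "0 < C * g * (norm x)\<^sup>2" using Cg by simp
    then show "T x \<bullet> x < 0" using inner_le_on_neg[of x] x(1) by simp
  qed
  moreover have "positive_definite_on {x \<in> Ker\<^sup>\<bottom>. J x = x} (\<lambda>x y. T x \<bullet> y)"
    unfolding positive_definite_on_def
  proof (intro ballI impI)
    fix x assume x: "x \<in> {x \<in> Ker\<^sup>\<bottom>. J x = x}" "x \<noteq> 0"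
    then have "0 < C * g * (norm x)\<^sup>2" using Cg by simp
    then show "0 < T x \<bullet> x" using inner_ge_on_pos[of x] x(1) by simp
  qed
  moreover have "orthogonal x y" if "x \<in> Ker\<^sup>\<bottom>" "y \<in> Ker" for x y
    using that unfolding orth_comp_iff orthogonal_def by blast
  moreover have "T x \<in> Ker\<^sup>\<bottom>" for x using range_eq by blast
  ultimately show ?thesis
    unfolding spectral_splitting_def Let_def
    using closed_subspace.sub[OF s.closed_subspace_neg] closed_subspace.clo[OF s.closed_subspace_neg]
      P clP orth sign_ker dec TN TP by auto
qed

text \<open>
  A negative definite closed invariant subspace is preserved by \<open>Y\<close>, hence it contains
  \<open>z = \<bar>U\<bar> x + U x\<close> for each of its elements \<open>x\<close>. As \<open>z\<close> lies in the positive part, it is \<open>0\<close>,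
  and \<open>J x = - x\<close>. In the same way, \<open>\<bar>U\<bar> x - U x = 0\<close> on the positive definite part. Thus both parts lie in
  the eigenspaces of \<open>J\<close>, and as they span the whole space together with the kernel, \<open>N\<close> is all of the
  eigenspace for \<open>-1\<close>.
\<close>

lemma spectral_splitting_unique:
  assumes "spectral_splitting UNIV T N P"
  shows "N = {x. J x = - x}"
proof -
  have N: "subspace N" "closed N" "T ` N \<subseteq> N" and P: "subspace P" "closed P" "T ` P \<subseteq> P"
    and NK: "N \<subseteq> Ker\<^sup>\<bottom>" and PK: "P \<subseteq> Ker\<^sup>\<bottom>"
    and dec: "\<And>w. \<exists>x\<in>N. \<exists>y\<in>P. \<exists>z\<in>Ker. w = x + y + z"
    and neg: "\<And>x. x \<in> N \<Longrightarrow> x \<noteq> 0 \<Longrightarrow> T x \<bullet> x < 0"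
    and pos: "\<And>x. x \<in> P \<Longrightarrow> x \<noteq> 0 \<Longrightarrow> 0 < T x \<bullet> x"
    using assms
    unfolding spectral_splitting_def Let_def negative_definite_on_def positive_definite_on_def
      orthogonal_def orth_comp_iff subset_iff by auto
  have Uinv: "U ` W \<subseteq> W" if "subspace W" "T ` W \<subseteq> W" "W \<subseteq> Ker\<^sup>\<bottom>" for W
  proof
    fix v assume "v \<in> U ` W"
    then obtain x where x: "x \<in> W" "v = U x" by blast
    then have v: "v = inverse C *\<^sub>R T x" using that(3) K.proj_zero by auto
    show "v \<in> W" unfolding v by (rule subspace_scale) (use that x in auto)
  qed
  have Nsub: "J x = - x" if x: "x \<in> N" for x
  proof -
    define z where "z = x - Y x + U x"
    have "Y x \<in> N" "U x \<in> N"
      using s.Y_invariant[OF N(1,2) Uinv[OF N(1,3) NK]] Uinv[OF N(1,3) NK] x by auto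
    then have zN: "z \<in> N" unfolding z_def using x N(1) by (intro subspace_add subspace_diff)
    have "J z = z" unfolding z_def by (rule s.sign_abs_plus)
    then have "0 \<le> T z \<bullet> z"
      using inner_ge_on_pos[of z] zN NK C s.g_pos
      by (meson mult_nonneg_nonneg order.trans less_imp_le subset_iff zero_le_power2)
    then have "z = 0" using neg[OF zN] by fastforce
    then show ?thesis
      by (intro s.sign_eqI) (simp add: z_def linear_neg[OF s.linY] eq_neg_iff_add_eq_0 algebra_simps)
  qed
  have Psub: "J x = x" if x: "x \<in> P" for x
  proof -
    define z where "z = x - Y x - U x"
    have "Y x \<in> P" "U x \<in> P"
      using s.Y_invariant[OF P(1,2) Uinv[OF P(1,3) PK]] Uinv[OF P(1,3) PK] x by auto
    then have zP: "z \<in> P" unfolding z_def using x P(1) by (intro subspace_diff)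
    have "J z = - z" unfolding z_def by (rule s.sign_abs_minus)
    then have "T z \<bullet> z \<le> - (C * g) * (norm z)\<^sup>2" by (rule inner_le_on_neg)
    moreover have "0 \<le> C * g * (norm z)\<^sup>2" using C s.g_pos by simp
    ultimately have "z = 0" using pos[OF zP] by fastforce
    then show ?thesis by (intro s.sign_eqI) (simp add: z_def)
  qed
  show ?thesis
  proof (intro set_eqI iffI)
    fix w assume w: "w \<in> {x. J x = - x}"
    obtain x y z where d: "x \<in> N" "y \<in> P" "z \<in> Ker" "w = x + y + z" using dec by blast
    have 1: "J (w - x) = - (w - x)" using w Nsub[OF d(1)] by (simp add: linear_diff[OF s.linJ])
    have "w - x = y + z" using d by simp
    then have "J (w - x) = w - x" using Psub[OF d(2)] sign_ker d(3) by (simp add: linear_add[OF s.linJ])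
    then have "(w - x) \<bullet> (w - x) = 0" using neg_perp_pos[OF 1] by simp
    then have "w = x" by simp
    then show "w \<in> N" using d(1) by simp
  qed (use Nsub in auto)
qed

lemma neg_space_eq: "neg_space UNIV T = {x. J x = - x}"
  unfolding neg_space_def
  using spectral_splitting_sign spectral_splitting_unique by (intro the_equality) blast+

end

lemma sign_obtain:
  obtains C g Y J where "C > 0" "operator_sign g (\<lambda>x. inverse C *\<^sub>R (T x + orth_proj Ker x)) Y J"
proof -
  obtain C where C: "C \<ge> 1" "\<exists>g Y J. operator_sign g (\<lambda>x. inverse C *\<^sub>R (T x + orth_proj Ker x)) Y J"
    using operator_sign_exists_scaled by blast
  then show thesis using that[of C] by auto
qed

lemma spectral_splitting_neg_space: "\<exists>P. spectral_splitting UNIV T (neg_space UNIV T) P"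
proof -
  obtain C g Y J where s: "C > 0" "operator_sign g (\<lambda>x. inverse C *\<^sub>R (T x + orth_proj Ker x)) Y J"
    by (rule sign_obtain)
  show ?thesis unfolding neg_space_eq[OF s] using spectral_splitting_sign[OF s] by blast
qed

lemma uniformly_negative: "\<exists>c>0. \<forall>x\<in>neg_space UNIV T. T x \<bullet> x \<le> - c * (norm x)\<^sup>2"
proof -
  obtain C g Y J where s: "C > 0" "operator_sign g (\<lambda>x. inverse C *\<^sub>R (T x + orth_proj Ker x)) Y J"
    by (rule sign_obtain)
  have "0 < C * g" using s operator_sign.g_pos by fastforce
  then show ?thesis unfolding neg_space_eq[OF s] using inner_le_on_neg[OF s] by blast
qed

end

text \<open>
  With a common scale \<open>C\<close>, the scaled operators differ by a compact operator, hence so do their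
  signs, and the projections are \<open>(1 - J) / 2\<close>.
\<close>

lemma commensurable_neg_spaces:
  fixes T T' :: "'a::{real_inner, complete_space} \<Rightarrow> 'a"
  assumes T: "symmetric_closed_range T" and T': "symmetric_closed_range T'"
    and K: "finite_dimensional {x. T x = 0}" and K': "finite_dimensional {x. T' x = 0}"
    and cT: "compact_operator (\<lambda>x. T x - T' x)"
  shows "commensurable (neg_space UNIV T) (neg_space UNIV T')"
proof -
  interpret T: symmetric_closed_range T by fact
  interpret T': symmetric_closed_range T' by fact
  obtain C0 where C0: "C0 \<ge> 1" "\<And>C. C \<ge> C0 \<Longrightarrow>
      \<exists>g Y J. operator_sign g (\<lambda>x. inverse C *\<^sub>R (T x + orth_proj T.Ker x)) Y J"
    using T.operator_sign_exists_scaled by blast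
  obtain C0' where C0': "C0' \<ge> 1" "\<And>C. C \<ge> C0' \<Longrightarrow>
      \<exists>g Y J. operator_sign g (\<lambda>x. inverse C *\<^sub>R (T' x + orth_proj T'.Ker x)) Y J"
    using T'.operator_sign_exists_scaled by blast
  define C where "C = max C0 C0'"
  have C: "C > 0" "C \<ge> C0" "C \<ge> C0'" using C0(1) by (auto simp: C_def)
  obtain g Y J where s: "operator_sign g (\<lambda>x. inverse C *\<^sub>R (T x + orth_proj T.Ker x)) Y J"
    using C0(2)[OF C(2)] by blast
  obtain g' Y' J' where s': "operator_sign g' (\<lambda>x. inverse C *\<^sub>R (T' x + orth_proj T'.Ker x)) Y' J'"
    using C0'(2)[OF C(3)] by blast
  have "compact_operator (\<lambda>x. inverse C *\<^sub>R ((T x - T' x) + (orth_proj T.Ker x - orth_proj T'.Ker x)))"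
    by (intro compact_operator_scaleR compact_operator_add compact_operator_diff cT
        compact_operator_proj K K' closed_subspace.sub T.closed_subspace_ker T'.closed_subspace_ker)
  then have "compact_operator (\<lambda>x. inverse C *\<^sub>R (T x + orth_proj T.Ker x) -
      inverse C *\<^sub>R (T' x + orth_proj T'.Ker x))"
    by (simp add: algebra_simps)
  then have cJ: "compact_operator (\<lambda>x. J x - J' x)" by (rule operator_sign_difference_compact[OF s s'])
  have "compact_operator (\<lambda>x. (- 1/2) *\<^sub>R (J x - J' x))" by (rule compact_operator_scaleR[OF cJ])
  moreover have "(- 1/2) *\<^sub>R (J x - J' x) = (1/2) *\<^sub>R (x - J x) - (1/2) *\<^sub>R (x - J' x)" for x
    by (simp add: algebra_simps)
  ultimately have "compact_operator (\<lambda>x. orth_proj (neg_space UNIV T) x - orth_proj (neg_space UNIV T') x)"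
    unfolding T.neg_space_eq[OF C(1) s] T'.neg_space_eq[OF C(1) s']
      operator_sign.proj_neg[OF s] operator_sign.proj_neg[OF s'] by simp
  then show ?thesis
    unfolding commensurable_def T.neg_space_eq[OF C(1) s] T'.neg_space_eq[OF C(1) s']
    using operator_sign.closed_subspace_neg[OF s] operator_sign.closed_subspace_neg[OF s']
    by (simp add: closed_subspace_def)
qed

context symmetric_closed_range
begin

lemma
  shows neg_space_closed_subspace: "closed_subspace (neg_space UNIV T)"
    and neg_space_invariant: "x \<in> neg_space UNIV T \<Longrightarrow> T x \<in> neg_space UNIV T"
    and neg_space_le: "x \<in> neg_space UNIV T \<Longrightarrow> T x \<bullet> x \<le> 0"
    and neg_space_zero: "x \<in> neg_space UNIV T \<Longrightarrow> 0 \<le> T x \<bullet> x \<Longrightarrow> x = 0"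
    and neg_space_subset_range: "neg_space UNIV T \<subseteq> range T"
    and nonneg_on_perp: "x \<in> (neg_space UNIV T)\<^sup>\<bottom> \<Longrightarrow> 0 \<le> T x \<bullet> x"
    and neg_space_surj: "y \<in> neg_space UNIV T \<Longrightarrow> \<exists>z\<in>neg_space UNIV T. T z = y"
proof -
  let ?N = "neg_space UNIV T"
  obtain P where P: "spectral_splitting UNIV T ?N P" using spectral_splitting_neg_space by blast
  have N: "subspace ?N" "closed ?N" and inv: "\<And>x. x \<in> ?N \<Longrightarrow> T x \<in> ?N" "\<And>x. x \<in> P \<Longrightarrow> T x \<in> P"
    and sP: "subspace P"
    and NP: "\<And>x y. x \<in> ?N \<Longrightarrow> y \<in> P \<Longrightarrow> x \<bullet> y = 0"
    and NK: "\<And>x y. x \<in> ?N \<Longrightarrow> T y = 0 \<Longrightarrow> x \<bullet> y = 0"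
    and dec: "\<And>w. \<exists>x\<in>?N. \<exists>y\<in>P. \<exists>z\<in>Ker. w = x + y + z"
    and neg: "\<And>x. x \<in> ?N \<Longrightarrow> x \<noteq> 0 \<Longrightarrow> T x \<bullet> x < 0"
    and pos: "\<And>x. x \<in> P \<Longrightarrow> x \<noteq> 0 \<Longrightarrow> 0 < T x \<bullet> x"
    using P
    unfolding spectral_splitting_def Let_def negative_definite_on_def positive_definite_on_def
      orthogonal_def subset_iff by auto
  show "closed_subspace ?N" using N by unfold_locales
  show "T x \<in> ?N" if "x \<in> ?N" for x using inv that by blast
  show "T x \<bullet> x \<le> 0" if "x \<in> ?N" for x using neg[OF that] by (cases "x = 0") auto
  show "x = 0" if "x \<in> ?N" "0 \<le> T x \<bullet> x" for x using neg[OF that(1)] that(2) by fastforce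
  show range: "?N \<subseteq> range T"
    unfolding range_eq using NK by (auto simp: orth_comp_iff)
  show "0 \<le> T x \<bullet> x" if x: "x \<in> ?N\<^sup>\<bottom>" for x
  proof -
    obtain n p k where d: "n \<in> ?N" "p \<in> P" "T k = 0" "x = n + p + k" using dec[of x] by blast
    have "x \<bullet> n = 0" using x d(1) unfolding orth_comp_iff by blast
    moreover have "x \<bullet> n = n \<bullet> n"
      using NP[OF d(1,2)] NK[OF d(1,3)] by (simp add: d(4) inner_add_left inner_add_right inner_commute)
    ultimately have "n = 0" by simp
    then have "T x \<bullet> x = T p \<bullet> p + p \<bullet> T k"
      using d(3,4) sym[of p k] by (simp add: linear_add[OF lin] inner_add_right)
    then show ?thesis using pos[OF d(2)] d(3) by (cases "p = 0") (auto simp: linear_0[OF lin])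
  qed
  show "\<exists>z\<in>?N. T z = y" if y: "y \<in> ?N" for y
  proof -
    obtain w where w: "y = T w" using y range by blast
    obtain n p k where d: "n \<in> ?N" "p \<in> P" "T k = 0" "w = n + p + k" using dec[of w] by blast
    have "y = T n + T p" using w d by (simp add: linear_add[OF lin])
    then have "T p = y - T n" by simp
    then have "T p \<in> ?N" using y inv(1)[OF d(1)] N(1) by (simp add: subspace_diff)
    then have "T p \<bullet> T p = 0" using NP inv(2)[OF d(2)] by blast
    then show ?thesis using \<open>y = T n + T p\<close> d(1) by auto
  qed
qed

end

section \<open>Maximal negative subspaces\<close>

lemma basis_extension_card:
  assumes S: "finite_dimensional S" and RS: "R \<subseteq> S"
  obtains c where "finite c" "c \<subseteq> S" "S \<subseteq> span (R \<union> c)" "card c + dim R = dim S"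
proof -
  obtain b where b: "b \<subseteq> R" "independent b" "finite b" "R \<subseteq> span b" "card b = dim R"
    using finite_dimensional_basis[OF finite_dimensional_subset[OF S RS]] by metis
  have "b \<subseteq> S" using b(1) RS by blast
  then obtain B where B: "b \<subseteq> B" "B \<subseteq> S" "independent B" "S \<subseteq> span B"
    using maximal_independent_subset_extend[OF _ b(2)] by metis
  obtain F where F: "finite F" "S \<subseteq> span F" using S unfolding finite_dimensional_def by blast
  have fB: "finite B" using independent_span_bound[OF F(1) B(3)] B(2) F(2) by blast
  have "card B = dim S" using basis_card_eq_dim[OF B(2,4,3)] .
  moreover have "card (B - b) + card b = card B"
    using card_Diff_subset[OF b(3) B(1)] card_mono[OF fB B(1)] by simp
  moreover have "S \<subseteq> span (R \<union> (B - b))"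
  proof -
    have "B \<subseteq> R \<union> (B - b)" using b(1) by blast
    then show ?thesis using B(4) span_mono by blast
  qed
  ultimately show thesis using that[of "B - b"] fB B(2) b(5) by auto
qed

definition neg_subspace :: "('a::real_inner \<Rightarrow> 'a) \<Rightarrow> 'a set \<Rightarrow> 'a set \<Rightarrow> bool" where
  "neg_subspace T W F \<longleftrightarrow> subspace F \<and> F \<subseteq> W \<and> negative_definite_on F (\<lambda>x y. T x \<bullet> y)"

lemma neg_subspaceD:
  assumes "neg_subspace T W F"
  shows "subspace F" "F \<subseteq> W" "x \<in> F \<Longrightarrow> 0 \<le> T x \<bullet> x \<Longrightarrow> x = 0"
  using assms unfolding neg_subspace_def negative_definite_on_def by force+

lemma maximal_neg_subspace_exists:
  assumes W: "finite_dimensional W" and F0: "neg_subspace T W F0"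
  obtains F where "neg_subspace T W F" "F0 \<subseteq> F"
    "\<And>G. neg_subspace T W G \<Longrightarrow> F0 \<subseteq> G \<Longrightarrow> dim G \<le> dim F"
proof -
  have "\<forall>G. neg_subspace T W G \<and> F0 \<subseteq> G \<longrightarrow> dim G < Suc (dim W)"
    using dim_le_of_subset[OF W] neg_subspaceD(2) by (metis less_Suc_eq_le)
  with F0 have "\<exists>F. (neg_subspace T W F \<and> F0 \<subseteq> F) \<and>
      (\<forall>G. neg_subspace T W G \<and> F0 \<subseteq> G \<longrightarrow> dim G \<le> dim F)"
    by (intro ex_has_greatest_nat[where k = F0]) auto
  then show thesis using that by blast
qed

lemma n_minus_eq_dim:
  assumes W: "finite_dimensional W" and F: "neg_subspace T W F"
    and max: "\<And>G. neg_subspace T W G \<Longrightarrow> dim G \<le> dim F"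
  shows "n_minus W (\<lambda>x y. T x \<bullet> y) = enat (dim F)"
proof -
  have e: "edim G = enat (dim G)" if "neg_subspace T W G" for G
    using finite_dimensional_subset[OF W neg_subspaceD(2)[OF that]] by (simp add: edim_def)
  have eq: "{S. subspace S \<and> S \<subseteq> W \<and> negative_definite_on S (\<lambda>x y. T x \<bullet> y)} = {G. neg_subspace T W G}"
    unfolding neg_subspace_def ..
  show ?thesis
    unfolding n_minus_def eq
  proof (rule antisym)
    show "Sup (edim ` {G. neg_subspace T W G}) \<le> enat (dim F)"
      by (rule Sup_least) (use e max in auto)
    show "enat (dim F) \<le> Sup (edim ` {G. neg_subspace T W G})"
      by (rule Sup_upper) (use e[OF F] F in force)
  qed
qed

context
  fixes T :: "'a::real_inner \<Rightarrow> 'a"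
  assumes lin: "linear T" and sym: "\<And>x y. T x \<bullet> y = x \<bullet> T y"
begin

text \<open>
  Orthogonal projection onto \<open>F\<close> for the form: the \<open>dim F\<close> conditions cannot cut the
  space spanned by \<open>F\<close> and \<open>y\<close> down to \<open>0\<close>.
\<close>

lemma form_projection_exists:
  assumes F: "neg_subspace T W F" and fd: "finite_dimensional F"
  shows "\<exists>f\<in>F. \<forall>g\<in>F. T (y - f) \<bullet> g = 0"
proof (cases "y \<in> F")
  case True
  then show ?thesis by (intro bexI[of _ y]) (auto simp: linear_0[OF lin])
next
  case False
  have sF: "subspace F" using neg_subspaceD(1)[OF F] .
  then have spF: "span F = F" by (simp add: span_eq_iff)
  obtain b where b: "b \<subseteq> F" "independent b" "finite b" "F \<subseteq> span b" "card b = dim F"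
    using finite_dimensional_basis[OF fd] by metis
  have Fb: "F = span b" using b(1,4) sF span_minimal by blast
  have ind: "independent (insert y b)"
    using False b(2) Fb by (intro independent_insertI) auto
  let ?X = "span (insert y b)"
  let ?Z = "{x \<in> ?X. \<forall>g\<in>b. T x \<bullet> g = 0}"
  have "finite_dimensional ?Z"
    unfolding finite_dimensional_def using b(3) by (intro exI[of _ "insert y b"]) auto
  then have "dim ?X \<le> dim ?Z + card b"
    using dim_le_annihilator_plus_card[of ?X "\<lambda>x g. T x \<bullet> g" b] b(3)
      linear_compose[OF lin bounded_linear.linear[OF bounded_linear_inner_left]]
    by (simp add: o_def)
  moreover have "dim ?X = card b + 1"
  proof -
    have "y \<notin> b" using False b(1) by blast
    then have "card (insert y b) = card b + 1" using b(3) by simp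
    then show ?thesis using dim_span_eq_card_independent[OF ind] by (simp only:)
  qed
  ultimately have "dim ?Z \<noteq> 0" by simp
  have "\<not> ?Z \<subseteq> {0}"
  proof
    assume "?Z \<subseteq> {0}"
    then have "dim ?Z \<le> card ({} :: 'a set)" by (intro dim_le_card) auto
    then show False using \<open>dim ?Z \<noteq> 0\<close> by simp
  qed
  then obtain x where x: "x \<in> ?X" "\<And>g. g \<in> b \<Longrightarrow> T x \<bullet> g = 0" "x \<noteq> 0" by blast
  obtain t where t: "x - t *\<^sub>R y \<in> F" using x(1) unfolding span_insert Fb by blast
  have xF: "T x \<bullet> g = 0" if "g \<in> F" for g
  proof -
    have "g \<in> span b" using that Fb by simp
    then show ?thesis
      by (induction g rule: span_induct_alt) (simp_all add: inner_add_right x(2))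
  qed
  have "t \<noteq> 0"
  proof
    assume "t = 0"
    then have "x \<in> F" using t by simp
    then show False using neg_subspaceD(3)[OF F] xF x(3) by force
  qed
  define f where "f = - inverse t *\<^sub>R (x - t *\<^sub>R y)"
  have "f \<in> F" unfolding f_def using t sF by (intro subspace_scale)
  moreover have "y - f = inverse t *\<^sub>R x" using \<open>t \<noteq> 0\<close> by (simp add: f_def scaleR_diff_right)
  then have "T (y - f) \<bullet> g = 0" if "g \<in> F" for g using xF[OF that] by (simp add: linear_scale[OF lin])
  ultimately show ?thesis by blast
qed

text \<open>
  A negative vector orthogonal to \<open>F\<close> would span with \<open>F\<close> a larger negative subspace.
\<close>

lemma nonneg_if_maximal:
  assumes F: "neg_subspace T E F" and fd: "finite_dimensional E" and E: "subspace E"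
    and max: "\<And>G. neg_subspace T E G \<Longrightarrow> F \<subseteq> G \<Longrightarrow> dim G \<le> dim F"
    and e: "e \<in> E" "\<And>g. g \<in> F \<Longrightarrow> T e \<bullet> g = 0"
  shows "0 \<le> T e \<bullet> e"
proof (rule ccontr)
  assume "\<not> 0 \<le> T e \<bullet> e"
  then have neg: "T e \<bullet> e < 0" by simp
  have sF: "subspace F" and FE: "F \<subseteq> E" using neg_subspaceD[OF F] by auto
  have eF: "e \<notin> F" using e(2)[of e] neg by auto
  obtain b where b: "b \<subseteq> F" "independent b" "finite b" "F \<subseteq> span b" "card b = dim F"
    using finite_dimensional_basis[OF finite_dimensional_subset[OF fd FE]] by metis
  have Fb: "F = span b" using b(1,4) sF span_minimal by blast
  let ?G = "span (insert e b)"
  have "independent (insert e b)" using eF b(2) Fb by (intro independent_insertI) auto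
  then have dG: "dim ?G = dim F + 1"
    using dim_span_eq_card_independent b(3,5) eF Fb span_base[of e b] by (metis Suc_eq_plus1 card_insert_disjoint)
  have "negative_definite_on ?G (\<lambda>x y. T x \<bullet> y)"
    unfolding negative_definite_on_def
  proof (intro ballI impI)
    fix x assume x: "x \<in> ?G" "x \<noteq> 0"
    obtain t where t: "x - t *\<^sub>R e \<in> F" using x(1) unfolding span_insert Fb by blast
    define f where "f = x - t *\<^sub>R e"
    have xf: "x = f + t *\<^sub>R e" and f: "f \<in> F" using t by (simp_all add: f_def)
    have "T f \<bullet> e = 0" using e(2)[OF f] sym[of e f] by (simp add: inner_commute)
    then have ex: "T x \<bullet> x = T f \<bullet> f + t * t * (T e \<bullet> e)"
      using e(2)[OF f] by (simp add: xf linear_add[OF lin] linear_scale[OF lin] inner_add_left inner_add_right)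
    show "T x \<bullet> x < 0"
    proof (cases "f = 0")
      case True
      then have "t \<noteq> 0" using x(2) xf by auto
      then have "t * t > 0" by (metis not_real_square_gt_zero)
      then show ?thesis using ex True neg by (simp add: linear_0[OF lin] mult_pos_neg)
    next
      case False
      then have "T f \<bullet> f < 0" using neg_subspaceD(3)[OF F f] by force
      moreover have "t * t * (T e \<bullet> e) \<le> 0" using neg by (simp add: mult_nonneg_nonpos)
      ultimately show ?thesis using ex by simp
    qed
  qed
  moreover have "?G \<subseteq> E" using b(1) FE e(1) E by (intro span_minimal) auto
  ultimately have "neg_subspace T E ?G" unfolding neg_subspace_def by simp
  moreover have "F \<subseteq> ?G" unfolding Fb by (rule span_mono) auto
  ultimately have "dim ?G \<le> dim F" by (rule max)
  then show False using dG by simp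
qed

text \<open>
  The complement of \<open>F\<close> for the form is nonnegative. By the Cauchy-Schwarz inequality, an isotropic vector \<open>x\<close> in
  it is orthogonal to all of it; and together with \<open>F\<close> it spans \<open>E\<close>.
\<close>

lemma isotropic_in_radical:
  assumes F: "neg_subspace T E F" and fd: "finite_dimensional E" and E: "subspace E"
    and max: "\<And>G. neg_subspace T E G \<Longrightarrow> F \<subseteq> G \<Longrightarrow> dim G \<le> dim F"
    and x: "x \<in> E" "\<And>g. g \<in> F \<Longrightarrow> T x \<bullet> g = 0" "T x \<bullet> x = 0" and y: "y \<in> E"
  shows "T x \<bullet> y = 0"
proof -
  have sF: "subspace F" and FE: "F \<subseteq> E" using neg_subspaceD[OF F] by auto
  obtain f where f: "f \<in> F" "\<And>g. g \<in> F \<Longrightarrow> T (y - f) \<bullet> g = 0"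
    using form_projection_exists[OF F finite_dimensional_subset[OF fd FE]] by blast
  let ?S = "{e \<in> E. \<forall>g\<in>F. T e \<bullet> g = 0}"
  have S: "subspace ?S"
    using E by (auto simp: subspace_def linear_0[OF lin] linear_add[OF lin] linear_scale[OF lin] inner_add_left)
  have "(T x \<bullet> (y - f))\<^sup>2 \<le> (T x \<bullet> x) * (T (y - f) \<bullet> (y - f))"
  proof (rule semidefinite_Cauchy_Schwarz[OF lin sym S])
    show "0 \<le> T z \<bullet> z" if "z \<in> ?S" for z
      using nonneg_if_maximal[OF F fd E max] that by blast
    show "x \<in> ?S" using x by blast
    show "y - f \<in> ?S" using y f FE E by (auto intro: subspace_diff)
  qed
  then have "T x \<bullet> (y - f) = 0" using x(3) by simp
  then show ?thesis using x(2)[OF f(1)] by (simp add: inner_diff_right)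
qed

end

section \<open>Compression to a subspace of finite codimension\<close>

locale compression = symmetric_closed_range +
  fixes V :: "'a set"
  assumes fin_ker: "finite_dimensional {x. T x = 0}"
    and subV: "subspace V" and cloV: "closed V" and fin_codim: "finite_codimensional V"
begin

sublocale V: closed_subspace V using subV cloV by unfold_locales

definition T' :: "'a \<Rightarrow> 'a" where "T' x = V.\<pi> (T (V.\<pi> x))"

lemma T'_inner: "x \<in> V \<Longrightarrow> y \<in> V \<Longrightarrow> T' x \<bullet> y = T x \<bullet> y"
  by (simp add: T'_def V.proj_inner)

lemma bounded_linear_T': "bounded_linear T'"
  unfolding T'_def[abs_def]
  by (intro bounded_linear_compose[OF V.proj_bounded_linear] bounded_linear_compose[OF bl]
      V.proj_bounded_linear)

lemma finite_dimensional_perp: "finite_dimensional (V\<^sup>\<bottom>)"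
proof -
  obtain F where F: "finite F" "span (V \<union> F) = UNIV"
    using fin_codim unfolding finite_codimensional_def by blast
  let ?q = "\<lambda>x. x - V.\<pi> x"
  have lq: "linear ?q"
    by (intro linear_compose_sub linear_ident V.proj_linear)
  have "x \<in> span (?q ` F)" if x: "x \<in> V\<^sup>\<bottom>" for x
  proof -
    have "?q x \<in> ?q ` span (V \<union> F)" using F(2) by simp
    also have "\<dots> = span (?q ` (V \<union> F))" by (rule linear_span_image[OF lq, symmetric])
    also have "\<dots> \<subseteq> span (insert 0 (?q ` F))" by (rule span_mono) auto
    finally show ?thesis using V.proj_zero[OF x] by simp
  qed
  then show ?thesis unfolding finite_dimensional_def using F(1) by blast
qed

lemma obtain_perp_basis:
  obtains G where "finite G" "G \<subseteq> V\<^sup>\<bottom>" "\<forall>x. (\<forall>g\<in>G. x \<bullet> g = 0) \<longleftrightarrow> x \<in> V"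
proof -
  obtain G where G: "G \<subseteq> V\<^sup>\<bottom>" "finite G" "V\<^sup>\<bottom> \<subseteq> span G"
    using finite_dimensional_basis[OF finite_dimensional_perp] by metis
  have "x \<in> V" if x: "\<forall>g\<in>G. x \<bullet> g = 0" for x
  proof -
    have "x \<bullet> y = 0" if "y \<in> span G" for y
      using that by (induction y rule: span_induct_alt) (simp_all add: inner_add_right x)
    then have "x \<in> V\<^sup>\<bottom>\<^sup>\<bottom>" using G(3) by (auto simp: orth_comp_iff[of x])
    then show ?thesis using V.double_orth_comp by simp
  qed
  moreover have "x \<bullet> g = 0" if "x \<in> V" "g \<in> G" for x g
  proof -
    have "g \<in> V\<^sup>\<bottom>" using that(2) G(1) by blast
    then show ?thesis using that(1) unfolding orth_comp_iff by (metis inner_commute)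
  qed
  ultimately have "\<forall>x. (\<forall>g\<in>G. x \<bullet> g = 0) \<longleftrightarrow> x \<in> V" by (intro allI iffI ballI)
  with G(2,1) show thesis by (rule that)
qed

lemma linear_inner: "linear (\<lambda>x. x \<bullet> g)"
  by (rule bounded_linear.linear[OF bounded_linear_inner_left])

lemma linear_form: "linear (\<lambda>x. T x \<bullet> g)"
  using linear_compose[OF lin linear_inner] by (simp add: o_def)

lemmas dim_le_orthogonal = dim_le_annihilator_plus_card[where b = "\<lambda>x g. x \<bullet> g", OF _ linear_inner]
lemmas dim_le_form_orthogonal = dim_le_annihilator_plus_card[where b = "\<lambda>x g. T x \<bullet> g", OF _ linear_form]

text \<open>\<open>W\<close> is the orthogonal complement of \<open>V\<close> for the form of \<open>T\<close>, and \<open>V \<inter> W\<close> is the kernel of the compression.\<close>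

definition W :: "'a set" where "W = {x. T x \<in> V\<^sup>\<bottom>}"

lemma subspace_W: "subspace W"
  using subspace_orthogonal_comp[of V]
  by (auto simp: W_def subspace_def linear_0[OF lin] linear_add[OF lin] linear_scale[OF lin])

text \<open>
  \<open>T\<close> maps \<open>W\<close> into the finite-dimensional space \<open>V\<^sup>\<bottom>\<close> with a finite-dimensional kernel.
\<close>

lemma finite_dimensional_W: "finite_dimensional W"
proof -
  obtain G where G: "finite G" "G \<subseteq> V\<^sup>\<bottom>" "\<forall>x. (\<forall>g\<in>G. x \<bullet> g = 0) \<longleftrightarrow> x \<in> V"
    by (rule obtain_perp_basis)
  have "{x \<in> W. \<forall>g\<in>G. T x \<bullet> g = 0} \<subseteq> Ker"
  proof
    fix x assume "x \<in> {x \<in> W. \<forall>g\<in>G. T x \<bullet> g = 0}"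
    then have "T x \<in> V\<^sup>\<bottom>" "T x \<in> V" using G(3) by (auto simp: W_def)
    then have "T x \<bullet> T x = 0" unfolding orth_comp_iff[of "T x"] by blast
    then show "x \<in> Ker" by simp
  qed
  then have "finite_dimensional {x \<in> W. \<forall>g\<in>G. T x \<bullet> g = 0}"
    using finite_dimensional_subset[OF fin_ker] by blast
  then show ?thesis
    using dim_le_form_orthogonal[OF subspace_W G(1)] by blast
qed

lemma ker_T'_in_V: "x \<in> V \<Longrightarrow> T' x = 0 \<longleftrightarrow> x \<in> W"
proof -
  assume x: "x \<in> V"
  have "V.\<pi> (T x) = 0 \<longleftrightarrow> T x \<in> V\<^sup>\<bottom>"
  proof
    assume "V.\<pi> (T x) = 0"
    then show "T x \<in> V\<^sup>\<bottom>" using V.proj_perp[of "T x"] by simp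
  qed (rule V.proj_zero)
  then show ?thesis using x by (simp add: T'_def W_def)
qed

lemma finite_dimensional_ker_T': "finite_dimensional {x. T' x = 0}"
proof -
  obtain G where G: "finite G" "G \<subseteq> V\<^sup>\<bottom>" "\<forall>x. (\<forall>g\<in>G. x \<bullet> g = 0) \<longleftrightarrow> x \<in> V"
    by (rule obtain_perp_basis)
  have "{x \<in> {x. T' x = 0}. \<forall>g\<in>G. x \<bullet> g = 0} \<subseteq> W"
    using G(3) ker_T'_in_V by auto
  then have "finite_dimensional {x \<in> {x. T' x = 0}. \<forall>g\<in>G. x \<bullet> g = 0}"
    using finite_dimensional_subset[OF finite_dimensional_W] by blast
  then show ?thesis
    using dim_le_orthogonal[OF linear_subspace_kernel[OF bounded_linear.linear[OF bounded_linear_T']] G(1)] by blast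
qed

lemma closed_sum_finite_dimensional:
  assumes X: "subspace X" "closed X" and Y: "subspace (Y :: 'a set)" "finite_dimensional Y"
  shows "closed {x + y | x y. x \<in> X \<and> y \<in> Y}"
proof -
  obtain b where b: "b \<subseteq> Y" "finite b" "Y \<subseteq> span b"
    using finite_dimensional_basis[OF Y(2)] by metis
  have "span b = Y" using b(1,3) Y(1) span_minimal by blast
  moreover have "span X = X" using X(1) by (simp add: span_eq_iff)
  ultimately have "span (X \<union> b) = {x + y | x y. x \<in> X \<and> y \<in> Y}" by (simp only: span_Un)
  then show ?thesis using closed_span_Un_finite[OF b(2) X] by metis
qed

text \<open>
  \<open>T\<close> is bounded below on the complement of its kernel, and \<open>T V\<close> is the image of the part of
  \<open>V + Ker\<close> that lies there.
\<close>

lemma closed_image_V: "closed (T ` V)"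
proof -
  interpret K: closed_subspace Ker by (rule closed_subspace_ker)
  let ?X = "{v + k | v k. v \<in> V \<and> k \<in> Ker} \<inter> Ker\<^sup>\<bottom>"
  have "T ` V = T ` ?X"
  proof (intro equalityI subsetI)
    fix y assume "y \<in> T ` V"
    then obtain v where v: "v \<in> V" "y = T v" by blast
    have "- orth_proj Ker v \<in> Ker" using K.proj_in[of v] K.sub subspace_neg by blast
    then have "v - orth_proj Ker v \<in> {v + k | v k. v \<in> V \<and> k \<in> Ker}"
      using v(1) by (metis (mono_tags, lifting) add_uminus_conv_diff mem_Collect_eq)
    then have "v - orth_proj Ker v \<in> ?X" using K.proj_perp[of v] by blast
    moreover have "T (v - orth_proj Ker v) = y"
      using K.proj_in[of v] v(2) by (simp add: linear_diff[OF lin])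
    ultimately show "y \<in> T ` ?X" by blast
  next
    fix y assume "y \<in> T ` ?X"
    then obtain v k where "v \<in> V" "T k = 0" "y = T (v + k)" by auto
    then show "y \<in> T ` V" by (simp add: linear_add[OF lin])
  qed
  moreover have "complete (T ` ?X)"
  proof -
    obtain c where c: "c > 0" "\<forall>x\<in>Ker\<^sup>\<bottom>. c * norm x \<le> norm (T x)" using bounded_below by blast
    have "closed ?X"
      by (intro closed_Int closed_orth_comp closed_sum_finite_dimensional subV cloV K.sub fin_ker)
    moreover have "subspace ?X"
      by (intro subspace_inter subspace_orthogonal_comp subspace_sums subV K.sub)
    ultimately show ?thesis
      using complete_isometric_image[OF c(1) _ bl, of ?X] c(2) by (simp add: complete_eq_closed)
  qed
  ultimately show ?thesis by (simp add: complete_eq_closed)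
qed

text \<open>
  The projection of \<open>T V\<close> to \<open>V\<close> is \<open>(T V + V\<^sup>\<bottom>) \<inter> V\<close>, and adding the finite-dimensional space \<open>V\<^sup>\<bottom>\<close> to the closed
  space \<open>T V\<close> keeps it closed.
\<close>

lemma closed_range_T': "closed (range T')"
proof -
  have sTV: "subspace (T ` V)" by (rule linear_subspace_image[OF lin subV])
  let ?S = "{y + w | y w. y \<in> T ` V \<and> w \<in> V\<^sup>\<bottom>}"
  have "range T' = ?S \<inter> V"
  proof (intro equalityI subsetI)
    fix z assume "z \<in> range T'"
    then obtain x where z: "z = V.\<pi> (T (V.\<pi> x))" by (auto simp: T'_def)
    have "z = T (V.\<pi> x) + - (T (V.\<pi> x) - V.\<pi> (T (V.\<pi> x)))" by (simp add: z)
    moreover have "- (T (V.\<pi> x) - V.\<pi> (T (V.\<pi> x))) \<in> V\<^sup>\<bottom>"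
      using V.proj_perp subspace_orthogonal_comp subspace_neg by blast
    moreover have "T (V.\<pi> x) \<in> T ` V" by simp
    ultimately have "z \<in> ?S" by blast
    then show "z \<in> ?S \<inter> V" by (simp add: z)
  next
    fix z assume "z \<in> ?S \<inter> V"
    then obtain x w where z: "z = T x + w" "x \<in> V" "w \<in> V\<^sup>\<bottom>" "z \<in> V" by blast
    have "z = V.\<pi> (T x + w)" using z(1,4) V.proj_id by metis
    also have "\<dots> = T' x" using z by (simp add: T'_def linear_add[OF V.proj_linear] V.proj_zero)
    finally show "z \<in> range T'" by blast
  qed
  moreover have "closed (?S \<inter> V)"
    by (intro closed_Int cloV closed_sum_finite_dimensional sTV closed_image_V
        subspace_orthogonal_comp finite_dimensional_perp)
  ultimately show ?thesis by simp
qed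

sublocale C: symmetric_closed_range T'
proof (rule symmetric_closed_range.intro)
  show "T' x \<bullet> y = x \<bullet> T' y" for x y
    by (simp add: T'_def V.proj_sym sym)
qed (rule bounded_linear_T' closed_range_T')+

lemma compact_difference: "compact_operator (\<lambda>x. T x - T' x)"
proof -
  let ?Q = "orth_proj (V\<^sup>\<bottom>)"
  have Q: "compact_operator ?Q"
    by (intro compact_operator_proj subspace_orthogonal_comp finite_dimensional_perp)
  have eq: "x - V.\<pi> x = ?Q x" for x
    by (rule orth_proj_eqI[symmetric, OF subspace_orthogonal_comp V.proj_perp])
      (simp add: V.double_orth_comp)
  have "compact_operator (\<lambda>x. T (?Q x) + ?Q (T (V.\<pi> x)))"
    by (intro compact_operator_add compact_operator_compose_left[OF Q bl]
        compact_operator_compose_right[OF Q] bounded_linear_compose[OF bl] V.proj_bounded_linear)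
  then show ?thesis by (simp add: eq[symmetric] T'_def linear_diff[OF lin])
qed

text \<open>
  The kernel of \<open>T'\<close> is the kernel of the compression enlarged by \<open>V\<^sup>\<bottom>\<close>, so a subspace is orthogonal
  to the former if and only if it lies in \<open>V\<close> and is orthogonal to the latter.
\<close>

lemma spectral_splitting_compression:
  "spectral_splitting V (V.\<pi> \<circ> T) N P \<longleftrightarrow> spectral_splitting UNIV T' N P"
proof -
  let ?K = "{x \<in> V. (V.\<pi> \<circ> T) x = 0}"
  have T'V: "T' x = (V.\<pi> \<circ> T) x" if "x \<in> V" for x using that by (simp add: T'_def)
  have KK: "?K \<subseteq> {x \<in> UNIV. T' x = 0}" using T'V by auto
  have T'\<pi>: "T' (V.\<pi> x) = T' x" for x by (simp add: T'_def)
  have inn: "T' x \<bullet> y = (V.\<pi> \<circ> T) x \<bullet> y" if "x \<in> V" for x y using T'V[OF that] by simp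
  show ?thesis
  proof
    assume "spectral_splitting V (V.\<pi> \<circ> T) N P"
    note L = this[unfolded spectral_splitting_def Let_def]
    have sub: "subspace N" "closed N" "subspace P" "closed P" and NV: "N \<subseteq> V" and PV: "P \<subseteq> V"
      and NP: "\<forall>x\<in>N. \<forall>y\<in>P. orthogonal x y"
      and NK: "\<forall>x\<in>N. \<forall>y\<in>?K. orthogonal x y" and PK: "\<forall>x\<in>P. \<forall>y\<in>?K. orthogonal x y"
      and dec: "\<forall>w\<in>V. \<exists>x\<in>N. \<exists>y\<in>P. \<exists>z\<in>?K. w = x + y + z"
      and inv: "(V.\<pi> \<circ> T) ` N \<subseteq> N" "(V.\<pi> \<circ> T) ` P \<subseteq> P"
      and neg: "negative_definite_on N (\<lambda>x y. (V.\<pi> \<circ> T) x \<bullet> y)"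
      and pos: "positive_definite_on P (\<lambda>x y. (V.\<pi> \<circ> T) x \<bullet> y)"
      using L by - (elim conjE, assumption)+
    have orthK: "orthogonal x y" if "x \<in> V" "\<forall>y\<in>?K. orthogonal x y" "T' y = 0" for x y
    proof -
      have "V.\<pi> y \<in> ?K" using T'V[of "V.\<pi> y"] T'\<pi>[of y] that(3) by simp
      then have "x \<bullet> V.\<pi> y = 0" using that(2) by (simp add: orthogonal_def)
      then show ?thesis using V.proj_inner'[OF that(1), of y] by (simp add: orthogonal_def)
    qed
    have "\<exists>x\<in>N. \<exists>y\<in>P. \<exists>z\<in>{x \<in> UNIV. T' x = 0}. w = x + y + z" for w
    proof -
      obtain x y z where d: "x \<in> N" "y \<in> P" "z \<in> ?K" "V.\<pi> w = x + y + z"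
        using bspec[OF dec V.proj_in[of w]] by (elim bexE)
      have "T' (w - V.\<pi> w) = 0" by (simp add: linear_diff[OF C.lin] T'\<pi>)
      moreover have "T' z = 0" using d(3) KK by blast
      ultimately have "T' (z + (w - V.\<pi> w)) = 0" by (simp add: linear_add[OF C.lin])
      moreover have "w = x + y + (z + (w - V.\<pi> w))" unfolding d(4) by simp
      ultimately show ?thesis using d(1,2) by (intro bexI) auto
    qed
    then have "\<forall>w\<in>UNIV. \<exists>x\<in>N. \<exists>y\<in>P. \<exists>z\<in>{x \<in> UNIV. T' x = 0}. w = x + y + z" by (intro ballI)
    moreover have "T' ` N = (V.\<pi> \<circ> T) ` N" "T' ` P = (V.\<pi> \<circ> T) ` P"
      by (intro image_cong refl T'V subsetD[OF NV] subsetD[OF PV]; assumption)+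
    then have "T' ` N \<subseteq> N" "T' ` P \<subseteq> P" using inv by (simp_all only:)
    moreover have "negative_definite_on N (\<lambda>x y. T' x \<bullet> y)"
      using neg inn NV by (simp add: negative_definite_on_def subset_iff)
    moreover have "positive_definite_on P (\<lambda>x y. T' x \<bullet> y)"
      using pos inn PV by (simp add: positive_definite_on_def subset_iff)
    moreover have "\<forall>x\<in>N. \<forall>y\<in>{x \<in> UNIV. T' x = 0}. orthogonal x y"
      using orthK NK NV by (simp add: subset_iff)
    moreover have "\<forall>x\<in>P. \<forall>y\<in>{x \<in> UNIV. T' x = 0}. orthogonal x y"
      using orthK PK PV by (simp add: subset_iff)
    ultimately show "spectral_splitting UNIV T' N P"
      unfolding spectral_splitting_def Let_def
      using sub NP by (intro conjI subset_UNIV)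
  next
    assume "spectral_splitting UNIV T' N P"
    note R = this[unfolded spectral_splitting_def Let_def]
    have sub: "subspace N" "closed N" "subspace P" "closed P"
      and NP: "\<forall>x\<in>N. \<forall>y\<in>P. orthogonal x y"
      and NK: "\<forall>x\<in>N. \<forall>y\<in>{x \<in> UNIV. T' x = 0}. orthogonal x y"
      and PK: "\<forall>x\<in>P. \<forall>y\<in>{x \<in> UNIV. T' x = 0}. orthogonal x y"
      and dec: "\<forall>w\<in>UNIV. \<exists>x\<in>N. \<exists>y\<in>P. \<exists>z\<in>{x \<in> UNIV. T' x = 0}. w = x + y + z"
      and inv: "T' ` N \<subseteq> N" "T' ` P \<subseteq> P"
      and neg: "negative_definite_on N (\<lambda>x y. T' x \<bullet> y)"
      and pos: "positive_definite_on P (\<lambda>x y. T' x \<bullet> y)"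
      using R by - (elim conjE, assumption)+
    have perp: "T' y = 0" if "y \<in> V\<^sup>\<bottom>" for y
      using V.proj_zero[OF that] by (simp add: T'_def linear_0[OF lin] linear_0[OF V.proj_linear])
    have inV: "x \<in> V" if x: "\<forall>y\<in>{x \<in> UNIV. T' x = 0}. orthogonal x y" for x
    proof -
      have "x \<in> V\<^sup>\<bottom>\<^sup>\<bottom>" unfolding orth_comp_iff[of x] using x perp by (auto simp: orthogonal_def)
      then show ?thesis using V.double_orth_comp by simp
    qed
    have NV: "N \<subseteq> V" and PV: "P \<subseteq> V"
      using NK PK inV by blast+
    have "\<exists>x\<in>N. \<exists>y\<in>P. \<exists>z\<in>?K. w = x + y + z" if w: "w \<in> V" for w
    proof -
      obtain x y z where d: "x \<in> N" "y \<in> P" "z \<in> {x \<in> UNIV. T' x = 0}" "w = x + y + z"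
        using bspec[OF dec UNIV_I[of w]] by (elim bexE)
      have "z = w - x - y" by (simp add: d(4))
      also have "\<dots> \<in> V" using w d(1,2) NV PV by (intro subspace_diff subV) auto
      finally have "z \<in> ?K" using d(3) T'V by simp
      then show ?thesis using d(1,2,4) by (intro bexI)
    qed
    then have "\<forall>w\<in>V. \<exists>x\<in>N. \<exists>y\<in>P. \<exists>z\<in>?K. w = x + y + z" by (intro ballI)
    moreover have "T' ` N = (V.\<pi> \<circ> T) ` N" "T' ` P = (V.\<pi> \<circ> T) ` P"
      by (intro image_cong refl T'V subsetD[OF NV] subsetD[OF PV]; assumption)+
    then have "(V.\<pi> \<circ> T) ` N \<subseteq> N" "(V.\<pi> \<circ> T) ` P \<subseteq> P" using inv by (simp_all only:)
    moreover have "negative_definite_on N (\<lambda>x y. (V.\<pi> \<circ> T) x \<bullet> y)"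
      using neg inn NV by (simp add: negative_definite_on_def subset_iff)
    moreover have "positive_definite_on P (\<lambda>x y. (V.\<pi> \<circ> T) x \<bullet> y)"
      using pos inn PV by (simp add: positive_definite_on_def subset_iff)
    moreover have "\<forall>x\<in>N. \<forall>y\<in>?K. orthogonal x y"
      using NK KK by (simp add: subset_iff)
    moreover have "\<forall>x\<in>P. \<forall>y\<in>?K. orthogonal x y"
      using PK KK by (simp add: subset_iff)
    ultimately show "spectral_splitting V (V.\<pi> \<circ> T) N P"
      unfolding spectral_splitting_def Let_def
      using sub NP NV PV by (intro conjI)
  qed
qed

lemma neg_space_compression: "neg_space V (V.\<pi> \<circ> T) = neg_space UNIV T'"
  unfolding neg_space_def spectral_splitting_compression ..

section \<open>The relative dimension of the negative spaces\<close>

abbreviation "N \<equiv> neg_space UNIV T"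
abbreviation "N' \<equiv> neg_space UNIV T'"

lemma range_T'_subset: "range T' \<subseteq> V"
  by (auto simp: T'_def)

lemma N'_subset: "N' \<subseteq> V"
  using C.neg_space_subset_range range_T'_subset by blast

lemma N'_inter_perp: "x \<in> N' \<Longrightarrow> x \<in> N\<^sup>\<bottom> \<Longrightarrow> x = 0"
  using C.neg_space_zero[of x] nonneg_on_perp[of x] T'_inner[of x x] N'_subset by auto

text \<open>
  \<open>E\<close> is the orthogonal complement, for the form of \<open>T\<close>, of the range of the compression. The form
  is nondegenerate on that range, so that the whole space is the direct sum of the range and \<open>E\<close>.
\<close>

definition E :: "'a set" where "E = {x. T x \<in> (range T')\<^sup>\<bottom>}"

lemma E_orth: "x \<in> E \<Longrightarrow> m \<in> range T' \<Longrightarrow> T x \<bullet> m = 0"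
  by (auto simp: E_def orth_comp_iff)

lemma subspace_E: "subspace E"
  using subspace_orthogonal_comp[of "range T'"]
  by (auto simp: E_def subspace_def linear_0[OF lin] linear_add[OF lin] linear_scale[OF lin])

lemma W_subset_E: "W \<subseteq> E"
  using orthogonal_comp_anti_mono[OF range_T'_subset] by (auto simp: W_def E_def)

lemma E_inter_V: "E \<inter> V = V \<inter> W"
proof
  show "E \<inter> V \<subseteq> V \<inter> W"
  proof
    fix x assume x: "x \<in> E \<inter> V"
    have "T' x \<bullet> T' x = T x \<bullet> T' x" using x range_T'_subset by (intro T'_inner) auto
    also have "\<dots> = 0" using x by (intro E_orth) auto
    finally show "x \<in> V \<inter> W" using x ker_T'_in_V by simp
  qed
qed (use W_subset_E in auto)

lemma finite_dimensional_E: "finite_dimensional E"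
proof -
  obtain G where G: "finite G" "G \<subseteq> V\<^sup>\<bottom>" "\<forall>x. (\<forall>g\<in>G. x \<bullet> g = 0) \<longleftrightarrow> x \<in> V"
    by (rule obtain_perp_basis)
  have "{x \<in> E. \<forall>g\<in>G. x \<bullet> g = 0} = E \<inter> V" using G(3) by auto
  then have "finite_dimensional {x \<in> E. \<forall>g\<in>G. x \<bullet> g = 0}"
    using finite_dimensional_subset[OF finite_dimensional_W] E_inter_V by auto
  then show ?thesis using dim_le_orthogonal[OF subspace_E G(1)] by blast
qed

text \<open>
  The functional \<open>u \<mapsto> T x \<bullet> u\<close> on the range of \<open>T'\<close> is represented by some \<open>m\<close> in the range, because \<open>T'\<close> maps
  its closed range onto itself.
\<close>

lemma range_plus_E: "\<exists>m\<in>range T'. x - m \<in> E"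
proof -
  interpret M: closed_subspace "range T'" by (rule C.closed_subspace_range)
  obtain y where y: "orth_proj (range T') (T x) = T' y" using M.proj_in[of "T x"] by blast
  define m where "m = orth_proj (range T') y"
  have m: "m \<in> range T'" unfolding m_def by (rule M.proj_in)
  have "y - m \<in> C.Ker"
  proof -
    have "T' (y - m) \<bullet> z = 0" for z
    proof -
      have "T' (y - m) \<bullet> z = (y - m) \<bullet> T' z" by (rule C.sym)
      also have "\<dots> = 0" using M.proj_perp[of y] unfolding m_def orth_comp_iff by blast
      finally show ?thesis .
    qed
    then show ?thesis using inner_eq_zero_iff by blast
  qed
  then have Tm: "T' m = T' y" by (simp add: linear_diff[OF C.lin])
  have "T (x - m) \<bullet> u = 0" if u: "u \<in> range T'" for u
  proof -
    have "T m \<bullet> u = T' m \<bullet> u" using T'_inner m u range_T'_subset by (metis subsetD)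
    also have "\<dots> = T x \<bullet> u" unfolding Tm y[symmetric] by (rule M.proj_inner[OF u])
    finally show ?thesis by (simp add: linear_diff[OF lin] inner_diff_left)
  qed
  then have "x - m \<in> E" by (auto simp: E_def orth_comp_iff)
  with m show ?thesis by blast
qed

lemma V_decomp:
  assumes v: "v \<in> V"
  shows "\<exists>m\<in>range T'. v - m \<in> V \<inter> W"
proof -
  obtain m where m: "m \<in> range T'" "v - m \<in> E" using range_plus_E by blast
  have "v - m \<in> V" using v m(1) range_T'_subset by (intro subspace_diff subV) auto
  then show ?thesis using m E_inter_V by blast
qed

text \<open>
  If \<open>F\<close> is maximal negative in \<open>E\<close>, then \<open>N' + F\<close> is maximal negative in the whole space, just as
  \<open>N\<close> is. Hence \<open>F\<close> and \<open>N \<inter> N'\<^sup>\<bottom>\<close> have the same dimension: the inner product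
  pairs them without a kernel on either side.
\<close>

lemma dim_neg_space_perp:
  assumes F: "neg_subspace T E F"
    and max: "\<And>G. neg_subspace T E G \<Longrightarrow> F \<subseteq> G \<Longrightarrow> dim G \<le> dim F"
  shows "dim (N \<inter> N'\<^sup>\<bottom>) = dim F"
proof -
  interpret N: closed_subspace N by (rule neg_space_closed_subspace)
  interpret N': closed_subspace N' by (rule C.neg_space_closed_subspace)
  let ?D = "N \<inter> N'\<^sup>\<bottom>"
  have sF: "subspace F" and FE: "F \<subseteq> E" using neg_subspaceD[OF F] by auto
  have fdF: "finite_dimensional F" using finite_dimensional_subset[OF finite_dimensional_E FE] .
  have sD: "subspace ?D" by (intro subspace_inter N.sub subspace_orthogonal_comp)
  \<comment> \<open>if \<open>x = T z\<close> with \<open>z \<in> N\<close> is orthogonal to \<open>N'\<close> and \<open>F\<close>, then \<open>z\<close> is so for the form;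
     by maximality the form is nonnegative at \<open>z\<close>, while it is negative definite on \<open>N\<close>\<close>
  have D0: "x = 0" if x: "x \<in> ?D" "\<And>f. f \<in> F \<Longrightarrow> x \<bullet> f = 0" for x
  proof -
    obtain z where z: "z \<in> N" "T z = x" using neg_space_surj x(1) by blast
    obtain m where m: "m \<in> range T'" "z - m \<in> E" using range_plus_E by blast
    define e where "e = z - m"
    have e: "e \<in> E" and zme: "z = m + e" using m(2) by (simp_all add: e_def)
    have mV: "m \<in> V" using m(1) range_T'_subset by blast
    have "T e \<bullet> f = 0" if f: "f \<in> F" for f
    proof -
      have "T e \<bullet> f = x \<bullet> f - T m \<bullet> f" by (simp add: e_def linear_diff[OF lin] inner_diff_left z(2))
      moreover have "T m \<bullet> f = 0" using E_orth[of f m] f FE m(1) sym[of m f] by (auto simp: inner_commute)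
      ultimately show ?thesis using x(2)[OF f] by simp
    qed
    then have ee: "0 \<le> T e \<bullet> e"
      using nonneg_if_maximal[OF lin sym F finite_dimensional_E subspace_E max e] by blast
    have mN': "T' m \<bullet> u = 0" if u: "u \<in> N'" for u
    proof -
      have "T' m \<bullet> u = T m \<bullet> u" using T'_inner[OF mV] u N'_subset by blast
      also have "\<dots> = x \<bullet> u - T e \<bullet> u" by (simp add: e_def linear_diff[OF lin] inner_diff_left z(2))
      also have "x \<bullet> u = 0" using x(1) u unfolding orth_comp_iff[of x] Int_iff by blast
      also have "T e \<bullet> u = 0" using E_orth[OF e] u C.neg_space_subset_range by blast
      finally show ?thesis by simp
    qed
    define n where "n = orth_proj N' m"
    have n: "n \<in> N'" unfolding n_def by (rule N'.proj_in)
    have "T' (m - n) \<bullet> n = 0"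
    proof -
      have "T' (m - n) \<bullet> n = (m - n) \<bullet> T' n" by (rule C.sym)
      then show ?thesis
        using N'.proj_perp[of m] C.neg_space_invariant[OF n] unfolding n_def[symmetric] orth_comp_iff by metis
    qed
    then have "T' n \<bullet> n = 0" using mN'[OF n] by (simp add: linear_diff[OF C.lin] inner_diff_left)
    then have "n = 0" using C.neg_space_zero[OF n] by simp
    then have "m \<in> N'\<^sup>\<bottom>" using N'.proj_perp[of m] by (simp add: n_def)
    then have "0 \<le> T m \<bullet> m" using C.nonneg_on_perp[of m] unfolding T'_inner[OF mV mV] by blast
    moreover have "T e \<bullet> m = 0" "T m \<bullet> e = 0"
      using E_orth[OF e m(1)] sym[of m e] by (auto simp: inner_commute)
    ultimately have "0 \<le> T z \<bullet> z"
      using ee by (simp add: zme linear_add[OF lin] inner_add_left inner_add_right)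
    then have "z = 0" using neg_space_zero[OF z(1)] by simp
    then show ?thesis using z(2) by (simp add: linear_0[OF lin])
  qed
  \<comment> \<open>a vector of \<open>F\<close> orthogonal to \<open>N \<inter> N'\<^sup>\<bottom>\<close> lies in \<open>N' + N\<^sup>\<bottom>\<close>; subtracting its component \<open>v\<close> in \<open>N'\<close>, to which
     it is orthogonal for the form, leaves a vector where the form is nonnegative\<close>
  have F0: "f = 0" if f: "f \<in> F" "\<And>d. d \<in> ?D \<Longrightarrow> f \<bullet> d = 0" for f
  proof -
    let ?p = "orth_proj N"
    obtain c where c: "c > 0" "\<And>x. x \<in> N' \<Longrightarrow> T' x \<bullet> x \<le> - c * (norm x)\<^sup>2"
      using C.uniformly_negative by blast
    obtain b where b: "b > 0" "\<And>x. norm (T x) \<le> norm x * b"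
      using bounded_linear.pos_bounded[OF bl] by blast
    \<comment> \<open>the image of \<open>N'\<close> in \<open>N\<close> is closed, because the projection is bounded below on \<open>N'\<close>\<close>
    have below: "sqrt (c / b) * norm x \<le> norm (?p x)" if x: "x \<in> N'" for x
    proof -
      define q where "q = x - ?p x"
      have q: "q \<in> N\<^sup>\<bottom>" unfolding q_def by (rule N.proj_perp)
      have "T (?p x) \<bullet> q = 0"
        using q neg_space_invariant[OF N.proj_in] unfolding orth_comp_iff by (metis inner_commute)
      moreover then have "T q \<bullet> ?p x = 0" using sym[of q "?p x"] by (simp add: inner_commute)
      moreover have "x = ?p x + q" by (simp add: q_def)
      then have "T x \<bullet> x = T (?p x + q) \<bullet> (?p x + q)" by simp
      ultimately have "T x \<bullet> x = T (?p x) \<bullet> ?p x + T q \<bullet> q"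
        by (simp add: linear_add[OF lin] inner_add_left inner_add_right)
      moreover have "T x \<bullet> x \<le> - c * (norm x)\<^sup>2"
        using c(2)[OF x] T'_inner[of x x] x N'_subset by auto
      moreover have "0 \<le> T q \<bullet> q" by (rule nonneg_on_perp[OF q])
      moreover have "\<bar>T (?p x) \<bullet> ?p x\<bar> \<le> norm (?p x) * b * norm (?p x)"
        using Cauchy_Schwarz_ineq2[of "T (?p x)" "?p x"] mult_right_mono[OF b(2)[of "?p x"] norm_ge_zero[of "?p x"]]
        by linarith
      ultimately have "c * (norm x)\<^sup>2 \<le> b * (norm (?p x))\<^sup>2" by (simp add: power2_eq_square algebra_simps)
      then have "(sqrt (c / b) * norm x)\<^sup>2 \<le> (norm (?p x))\<^sup>2"
        using b(1) c(1) by (simp add: power_mult_distrib field_simps)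
      then show ?thesis by (rule power2_le_imp_le) simp
    qed
    have "complete (?p ` N')"
      by (rule complete_isometric_image[where e = "sqrt (c / b)", OF _ N'.sub N.proj_bounded_linear])
        (use below b(1) c(1) N'.clo in \<open>auto simp: complete_eq_closed\<close>)
    then interpret Q: closed_subspace "?p ` N'"
      using linear_subspace_image[OF N.proj_linear N'.sub] by unfold_locales (simp_all add: complete_eq_closed)
    let ?q = "orth_proj (?p ` N')"
    define u where "u = ?p f - ?q (?p f)"
    have uQ: "u \<in> (?p ` N')\<^sup>\<bottom>" unfolding u_def by (rule Q.proj_perp)
    obtain v where v: "v \<in> N'" "?q (?p f) = ?p v" using Q.proj_in[of "?p f"] by (rule imageE)
    have qN: "?q (?p f) \<in> N" unfolding v(2) by (rule N.proj_in)
    have uN: "u \<in> N" unfolding u_def using qN by (intro subspace_diff N.sub) auto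
    have "u \<bullet> v = 0" if "v \<in> N'" for v
      using uQ that N.proj_inner'[OF uN, of v] unfolding orth_comp_iff by (metis imageI)
    then have "u \<in> ?D" using uN by (auto simp: orth_comp_iff)
    then have "0 = ?p f \<bullet> u" using f(2) N.proj_inner[OF uN] by simp
    also have "\<dots> = u \<bullet> u"
    proof -
      have "u \<bullet> ?q (?p f) = 0" using uQ Q.proj_in unfolding orth_comp_iff by blast
      then show ?thesis unfolding u_def by (simp add: inner_diff_left inner_diff_right inner_commute)
    qed
    finally have pv: "?p f = ?p v" unfolding v(2)[symmetric] by (simp add: u_def)
    have "f - v \<in> N\<^sup>\<bottom>"
      using N.proj_perp[of "f - v"] pv by (simp add: linear_diff[OF N.proj_linear])
    then have "0 \<le> T (f - v) \<bullet> (f - v)" by (rule nonneg_on_perp)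
    moreover have "T f \<bullet> v = 0" using E_orth[of f v] f(1) FE v(1) C.neg_space_subset_range by blast
    moreover then have "T v \<bullet> f = 0" using sym[of v f] by (simp add: inner_commute)
    moreover have "T v \<bullet> v \<le> 0"
      using C.neg_space_le[OF v(1)] T'_inner[of v v] v(1) N'_subset by auto
    ultimately have "0 \<le> T f \<bullet> f" by (simp add: linear_diff[OF lin] inner_diff_left inner_diff_right)
    then show ?thesis using neg_subspaceD(3)[OF F f(1)] by simp
  qed
  have pairing: "finite_dimensional X \<and> dim X \<le> card G"
    if "subspace X" "finite G"
      and nondeg: "\<And>x. x \<in> X \<Longrightarrow> (\<And>y. y \<in> span G \<Longrightarrow> x \<bullet> y = 0) \<Longrightarrow> x = 0" for X G :: "'a set"
  proof -
    have sub0: "{x \<in> X. \<forall>g\<in>G. x \<bullet> g = 0} \<subseteq> {0}"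
    proof
      fix x assume x: "x \<in> {x \<in> X. \<forall>g\<in>G. x \<bullet> g = 0}"
      have "x \<bullet> y = 0" if "y \<in> span G" for y
        using that by (induction y rule: span_induct_alt) (use x in \<open>simp_all add: inner_add_right\<close>)
      then show "x \<in> {0}" using nondeg x by blast
    qed
    then have "finite_dimensional {x \<in> X. \<forall>g\<in>G. x \<bullet> g = 0}"
      unfolding finite_dimensional_def by (intro exI[of _ "{}"]) simp
    moreover have "dim {x \<in> X. \<forall>g\<in>G. x \<bullet> g = 0} \<le> card ({} :: 'a set)"
      by (rule dim_le_card) (use sub0 in auto)
    ultimately show ?thesis using dim_le_orthogonal[OF that(1,2)] by simp
  qed
  obtain b where b: "b \<subseteq> F" "finite b" "F \<subseteq> span b" "card b = dim F"
    using finite_dimensional_basis[OF fdF] by metis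
  have 1: "finite_dimensional ?D \<and> dim ?D \<le> card b"
  proof (rule pairing[OF sD b(2)])
    show "x = 0" if "x \<in> ?D" "\<And>y. y \<in> span b \<Longrightarrow> x \<bullet> y = 0" for x
      using D0[OF that(1)] that(2) b(3) by blast
  qed
  obtain a where a: "a \<subseteq> ?D" "finite a" "?D \<subseteq> span a" "card a = dim ?D"
    using finite_dimensional_basis[OF conjunct1[OF 1]] by metis
  have "finite_dimensional F \<and> dim F \<le> card a"
  proof (rule pairing[OF sF a(2)])
    show "x = 0" if "x \<in> F" "\<And>y. y \<in> span a \<Longrightarrow> x \<bullet> y = 0" for x
      using F0[OF that(1)] that(2) a(3) by blast
  qed
  with 1 show ?thesis using a(4) b(4) by simp
qed

text \<open>
  Extending a maximal negative subspace of \<open>W\<close> to one of \<open>E\<close> adds one dimension for each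
  direction of the isotropic space \<open>V \<inter> W\<close> outside the kernel of \<open>T\<close>.
\<close>

lemma dim_neg_space_perp_eq:
  "n_minus W (\<lambda>x y. T x \<bullet> y) + enat (dim (V \<inter> W)) = enat (dim (N \<inter> N'\<^sup>\<bottom>)) + enat (dim (V \<inter> Ker))"
proof -
  have triv: "neg_subspace T W {0}"
    using subspace_0[OF subspace_W] by (simp add: neg_subspace_def negative_definite_on_def subspace_0)
  obtain F0 where F0: "neg_subspace T W F0"
    and max0: "\<And>G. neg_subspace T W G \<Longrightarrow> {0} \<subseteq> G \<Longrightarrow> dim G \<le> dim F0"
    using maximal_neg_subspace_exists[OF finite_dimensional_W triv] by metis
  have max0: "dim G \<le> dim F0" if "neg_subspace T W G" for G
    using max0[OF that] subspace_0[OF neg_subspaceD(1)[OF that]] by simp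
  have F0E: "neg_subspace T E F0" using F0 W_subset_E by (auto simp: neg_subspace_def)
  obtain F where F: "neg_subspace T E F" "F0 \<subseteq> F"
    and max1: "\<And>G. neg_subspace T E G \<Longrightarrow> F0 \<subseteq> G \<Longrightarrow> dim G \<le> dim F"
    using maximal_neg_subspace_exists[OF finite_dimensional_E F0E] by metis
  have max: "dim G \<le> dim F" if "neg_subspace T E G" "F \<subseteq> G" for G
    using max1 that F(2) by blast
  have sF: "subspace F" and FE: "F \<subseteq> E" using neg_subspaceD[OF F(1)] by auto
  have fdF: "finite_dimensional F" using finite_dimensional_subset[OF finite_dimensional_E FE] .
  have fdVW: "finite_dimensional (V \<inter> W)" using finite_dimensional_subset[OF finite_dimensional_W] by blast
  have kerW: "V \<inter> Ker \<subseteq> V \<inter> W" by (auto simp: W_def subspace_0 subspace_orthogonal_comp)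
  have WV: "T x \<bullet> v = 0" if "x \<in> W" "v \<in> V" for x v using that by (auto simp: W_def orth_comp_iff)
  \<comment> \<open>a vector of \<open>F\<close> that annihilates \<open>V \<inter> W\<close> annihilates \<open>V\<close>\<close>
  have upper: "dim F + dim (V \<inter> Ker) \<le> dim F0 + dim (V \<inter> W)"
  proof -
    obtain c where c: "finite c" "c \<subseteq> V \<inter> W" "V \<inter> W \<subseteq> span (V \<inter> Ker \<union> c)"
      "card c + dim (V \<inter> Ker) = dim (V \<inter> W)"
      using basis_extension_card[OF fdVW kerW] by metis
    let ?Z = "{x \<in> F. \<forall>g\<in>c. T x \<bullet> g = 0}"
    have "x \<in> W" if x: "x \<in> ?Z" for x
    proof -
      have VW: "T x \<bullet> k = 0" if "k \<in> V \<inter> W" for k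
      proof -
        have "k \<in> span (V \<inter> Ker \<union> c)" using that c(3) by blast
        then show ?thesis
        proof (induction k rule: span_induct_alt)
          case (step a g y)
          have "T x \<bullet> g = 0" using step(1) x sym[of x g] by auto
          then show ?case using step(2) by (simp add: inner_add_right)
        qed simp
      qed
      have "T x \<bullet> v = 0" if v: "v \<in> V" for v
      proof -
        obtain m where m: "m \<in> range T'" "v - m \<in> V \<inter> W" using V_decomp[OF v] by blast
        have "T x \<bullet> m = 0" using E_orth m(1) x FE by blast
        then show ?thesis using VW[OF m(2)] by (simp add: inner_diff_right)
      qed
      then show ?thesis by (auto simp: W_def orth_comp_iff)
    qed
    moreover have "subspace ?Z"
      using sF by (auto simp: subspace_def linear_0[OF lin] linear_add[OF lin] linear_scale[OF lin] inner_add_left)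
    ultimately have "neg_subspace T W ?Z"
      using F(1) by (auto simp: neg_subspace_def negative_definite_on_def)
    then have "dim ?Z \<le> dim F0" by (rule max0)
    moreover have "dim F \<le> dim ?Z + card c"
      using dim_le_form_orthogonal[OF sF c(1)] finite_dimensional_subset[OF fdF, of ?Z] by blast
    ultimately show ?thesis using c(4) by linarith
  qed
  \<comment> \<open>a vector of \<open>V \<inter> W\<close> that annihilates \<open>F\<close> is isotropic, hence in the kernel of \<open>T\<close>\<close>
  have lower: "dim (V \<inter> W) + dim F0 \<le> dim (V \<inter> Ker) + dim F"
  proof -
    obtain c where c: "finite c" "c \<subseteq> F" "F \<subseteq> span (F0 \<union> c)" "card c + dim F0 = dim F"
      using basis_extension_card[OF fdF F(2)] by metis
    let ?Z = "{x \<in> V \<inter> W. \<forall>g\<in>c. T x \<bullet> g = 0}"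
    have "?Z \<subseteq> V \<inter> Ker"
    proof
      fix x assume x: "x \<in> ?Z"
      have xF: "T x \<bullet> g = 0" if "g \<in> F" for g
      proof -
        have "g \<in> span (F0 \<union> c)" using that c(3) by blast
        then show ?thesis
        proof (induction g rule: span_induct_alt)
          case (step a g y)
          have "T x \<bullet> g = 0" if "g \<in> F0"
            using WV[of g x] x that neg_subspaceD(2)[OF F0] sym[of x g] by (auto simp: inner_commute)
          then have "T x \<bullet> g = 0" using step(1) x by blast
          then show ?case using step(2) by (simp add: inner_add_right)
        qed simp
      qed
      have xE: "x \<in> E" using x W_subset_E by blast
      have xx: "T x \<bullet> x = 0" using WV x by blast
      obtain m where m: "m \<in> range T'" "T x - m \<in> E" using range_plus_E by blast
      have "T x \<bullet> (T x - m) = 0"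
        by (rule isotropic_in_radical[OF lin sym F(1) finite_dimensional_E subspace_E max xE xF xx m(2)])
      moreover have "T x \<bullet> m = 0" using E_orth[OF xE m(1)] .
      ultimately have "T x \<bullet> T x = 0" by (simp add: inner_diff_right)
      then show "x \<in> V \<inter> Ker" using x by simp
    qed
    then have "dim ?Z \<le> dim (V \<inter> Ker)"
      using dim_le_of_subset[OF finite_dimensional_subset[OF fdVW kerW]] by blast
    moreover have "dim (V \<inter> W) \<le> dim ?Z + card c"
      using dim_le_form_orthogonal[OF subspace_inter[OF subV subspace_W] c(1)]
        finite_dimensional_subset[OF fdVW, of ?Z] by blast
    ultimately show ?thesis using c(4) by linarith
  qed
  have "dim (N \<inter> N'\<^sup>\<bottom>) = dim F" by (rule dim_neg_space_perp[OF F(1) max])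
  moreover have "n_minus W (\<lambda>x y. T x \<bullet> y) = enat (dim F0)"
    by (rule n_minus_eq_dim[OF finite_dimensional_W F0 max0])
  ultimately show ?thesis using upper lower by simp
qed

end

theorem proposition3p18:
  fixes B :: "'a::{real_inner, complete_space} \<Rightarrow> 'a \<Rightarrow> real"
    and T :: "'a \<Rightarrow> 'a"
    and V :: "'a set"
  assumes "separable_space (euclidean :: 'a topology)"
    and "symmetric_fredholm_form B"
    and "associated_operator B T"
    and "subspace V" and "closed V" and "finite_codimensional V"
  shows "commensurable (neg_space UNIV T) (neg_space V (orth_proj V \<circ> T)) \<and>
    ereal (real_of_int (relative_dim (neg_space UNIV T) (neg_space V (orth_proj V \<circ> T)))) =
      ereal_of_enat (n_minus (form_perp B V) B)
      + ereal_of_enat (edim (V \<inter> form_perp B V))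
      - ereal_of_enat (edim (V \<inter> {x. T x = 0}))"
proof -
  have B: "B = (\<lambda>x y. T x \<bullet> y)"
    using assms(3) by (intro ext) (simp add: associated_operator_def)
  have symB: "\<forall>x y. B x y = B y x"
    using assms(2) unfolding symmetric_fredholm_form_def by blast
  obtain S where S: "associated_operator B S" "fredholm_operator S"
    using assms(2) unfolding symmetric_fredholm_form_def by blast
  have "S x = T x" for x
  proof -
    have "S x \<bullet> y = T x \<bullet> y" for y
      using S(1) assms(3) by (simp add: associated_operator_def)
    then have "(S x - T x) \<bullet> (S x - T x) = 0" by (simp add: inner_diff_left)
    then show ?thesis by simp
  qed
  then have "S = T" by blast
  then have fr: "bounded_linear T" "finite_dimensional {x. T x = 0}" "closed (range T)"
    using S(2) by (auto simp: fredholm_operator_def)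
  have sym: "T x \<bullet> y = x \<bullet> T y" for x y
    using symB[rule_format, of x y] unfolding B by (simp only: inner_commute[of x])
  interpret compression T V
    by (intro compression.intro symmetric_closed_range.intro compression_axioms.intro)
      (fact fr sym assms(4-6))+
  have W: "form_perp B V = W"
    by (auto simp: form_perp_def W_def B orth_comp_iff)
  have fdVW: "finite_dimensional (V \<inter> W)" "finite_dimensional (V \<inter> Ker)"
    by (rule finite_dimensional_subset[OF finite_dimensional_W Int_lower2],
        rule finite_dimensional_subset[OF fr(2) Int_lower2])
  have "N' \<inter> N\<^sup>\<bottom> \<subseteq> {0}" using N'_inter_perp by blast
  then have "dim (N' \<inter> N\<^sup>\<bottom>) = 0" using dim_le_card[of "N' \<inter> N\<^sup>\<bottom>" "{}"] by simp
  then have rd: "relative_dim N N' = int (dim (N \<inter> N'\<^sup>\<bottom>))" by (simp add: relative_dim_def)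
  have "commensurable N N'"
    by (rule commensurable_neg_spaces)
      (use fr(2) finite_dimensional_ker_T' compact_difference symmetric_closed_range_axioms
        C.symmetric_closed_range_axioms in auto)
  moreover have "ereal (real_of_int (relative_dim N N')) =
      ereal_of_enat (n_minus W B) + ereal_of_enat (edim (V \<inter> W)) - ereal_of_enat (edim (V \<inter> Ker))"
  proof -
    obtain n where n: "n_minus W B = enat n"
      using dim_neg_space_perp_eq unfolding B by (cases "n_minus W (\<lambda>x y. T x \<bullet> y)") auto
    have "n + dim (V \<inter> W) = dim (N \<inter> N'\<^sup>\<bottom>) + dim (V \<inter> Ker)"
      using dim_neg_space_perp_eq n unfolding B by simp
    then have "real (dim (N \<inter> N'\<^sup>\<bottom>)) = real n + real (dim (V \<inter> W)) - real (dim (V \<inter> Ker))"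
      by linarith
    then show ?thesis using fdVW by (simp add: n rd edim_def)
  qed
  ultimately show ?thesis unfolding W neg_space_compression by blast
qed

end
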